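(* Both of the following problems are fixed-parameter tractable with respect to the parameter $d=|X|$. Input: a finite simple connected undirected graph $G$, a subset $X\subseteq V(G)$ such that $G\setminus X$ is a cluster graph, and an integer $k$. Question (CF-CN coloring): does $G$ have a conflict-free closed neighborhood coloring $V(G)\to\{1,\dots,k\}$? Question (CF-ON coloring): does $G$ have a conflict-free open neighborhood coloring $V(G)\to\{1,\dots,k\}$? That is, for each of the two problems there are a computable function $f$ and an algorithm that decides the problem in time $f(d)\cdot |V(G)|^{O(1)}$.
   Context: A cluster graph is a disjoint union of complete graphs. The cluster vertex deletion number of $G$ is the minimum size of a set $X\subseteq V(G)$ such that $G\setminus X$ (the graph obtained by deleting the vertices of $X$) is a cluster graph; such a set $X$ is called a modulator to cluster graphs and is assumed to be given as part of the input, the parameter being its size $d=|X|$. Let $N(v)$ be the set of vertices adjacent to $v$ and $N[v]=N(v)\cup\{v\}$. For a coloring $C_G:V(G)\to\{1,\dots,k\}$ (not necessarily proper), a set $U\subseteq V(G)$ has a unique color if there is a color $c$ with $|\{u\in U: C_G(u)=c\}|=1$. The coloring $C_G$ is a conflict-free closed neighborhood (CF-CN) coloring if $N[v]$ has a unique color for every $v\in V(G)$, and a conflict-free open neighborhood (CF-ON) coloring if $N(v)$ has a unique color for every $v\in V(G)$. *)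

theory Defs
  imports "Graph_Theory.Graph_Theory" "HOL-Library.Disjoint_Sets"
begin

section \<open>Graphs and conflict-free colorings\<close>

text \<open>Finite simple undirected graphs are the symmetric, irreflexive digraphs of the locale
  \<^locale>\<open>pair_graph\<close>; each edge is represented by both of its orientations.\<close>

definition open_neighborhood :: "'a pair_pre_digraph \<Rightarrow> 'a \<Rightarrow> 'a set" where
  "open_neighborhood G v = {u \<in> pverts G. (v, u) \<in> parcs G}"

definition closed_neighborhood :: "'a pair_pre_digraph \<Rightarrow> 'a \<Rightarrow> 'a set" where
  "closed_neighborhood G v = insert v (open_neighborhood G v)"

definition cluster_graph :: "('a, 'b) pre_digraph \<Rightarrow> bool" where
  "cluster_graph H \<longleftrightarrow>
     (\<exists>P. partition_on (verts H) P \<and>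
          arcs_ends H = (\<Union>K\<in>P. {(u, v). u \<in> K \<and> v \<in> K \<and> u \<noteq> v}))"

definition cluster_modulator :: "'a pair_pre_digraph \<Rightarrow> 'a set \<Rightarrow> bool" where
  "cluster_modulator G X \<longleftrightarrow>
     X \<subseteq> pverts G \<and> cluster_graph (with_proj G \<restriction> (pverts G - X))"

definition has_unique_color :: "('a \<Rightarrow> int) \<Rightarrow> 'a set \<Rightarrow> bool" where
  "has_unique_color C U \<longleftrightarrow> (\<exists>c. card {u \<in> U. C u = c} = 1)"

definition cf_cn_coloring :: "'a pair_pre_digraph \<Rightarrow> int \<Rightarrow> ('a \<Rightarrow> int) \<Rightarrow> bool" where
  "cf_cn_coloring G k C \<longleftrightarrow>
     C \<in> pverts G \<rightarrow> {1..k} \<and> (\<forall>v\<in>pverts G. has_unique_color C (closed_neighborhood G v))"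

definition cf_on_coloring :: "'a pair_pre_digraph \<Rightarrow> int \<Rightarrow> ('a \<Rightarrow> int) \<Rightarrow> bool" where
  "cf_on_coloring G k C \<longleftrightarrow>
     C \<in> pverts G \<rightarrow> {1..k} \<and> (\<forall>v\<in>pverts G. has_unique_color C (open_neighborhood G v))"


section \<open>The machine model\<close>

text \<open>A random access machine over the integers, in structured form: a program uses finitely many
  integer variables and finitely many arrays with integer entries, indexed by the integers.
  Every elementary operation costs one unit of time. The arithmetic operations are addition and
  subtraction only. With multiplication, numbers of exponential length could be produced by
  repeated squaring; without it, the unit-cost model is polynomially equivalent to Turing
  machines.\<close>

datatype aexp =
    Const int
  | Var nat
  | Read nat aexp
  | Add aexp aexp
  | Sub aexp aexp

datatype bexp =
    Less aexp aexp
  | Eq aexp aexp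
  | Not bexp
  | And bexp bexp

datatype com =
    Skip
  | Assign nat aexp
  | Store nat aexp aexp
  | Seq com com
  | If bexp com com
  | While bexp com

record store =
  vars :: "nat \<Rightarrow> int"
  arrs :: "nat \<Rightarrow> int \<Rightarrow> int"

primrec aval :: "aexp \<Rightarrow> store \<Rightarrow> int" where
  "aval (Const i) s = i"
| "aval (Var x) s = vars s x"
| "aval (Read a e) s = arrs s a (aval e s)"
| "aval (Add e1 e2) s = aval e1 s + aval e2 s"
| "aval (Sub e1 e2) s = aval e1 s - aval e2 s"

primrec bval :: "bexp \<Rightarrow> store \<Rightarrow> bool" where
  "bval (Less e1 e2) s \<longleftrightarrow> aval e1 s < aval e2 s"
| "bval (Eq e1 e2) s \<longleftrightarrow> aval e1 s = aval e2 s"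
| "bval (Not b) s \<longleftrightarrow> \<not> bval b s"
| "bval (And b1 b2) s \<longleftrightarrow> bval b1 s \<and> bval b2 s"

primrec acost :: "aexp \<Rightarrow> nat" where
  "acost (Const i) = 1"
| "acost (Var x) = 1"
| "acost (Read a e) = acost e + 1"
| "acost (Add e1 e2) = acost e1 + acost e2 + 1"
| "acost (Sub e1 e2) = acost e1 + acost e2 + 1"

primrec bcost :: "bexp \<Rightarrow> nat" where
  "bcost (Less e1 e2) = acost e1 + acost e2 + 1"
| "bcost (Eq e1 e2) = acost e1 + acost e2 + 1"
| "bcost (Not b) = bcost b + 1"
| "bcost (And b1 b2) = bcost b1 + bcost b2 + 1"

text \<open>\<open>exec c s t s'\<close>: started in store \<open>s\<close>, the program \<open>c\<close> halts after exactly \<open>t\<close> units of time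
  in store \<open>s'\<close>.\<close>

inductive exec :: "com \<Rightarrow> store \<Rightarrow> nat \<Rightarrow> store \<Rightarrow> bool" where
  Skip: "exec Skip s 1 s"
| Assign: "exec (Assign x e) s (acost e + 1) (s\<lparr>vars := (vars s)(x := aval e s)\<rparr>)"
| Store: "exec (Store a i e) s (acost i + acost e + 1)
    (s\<lparr>arrs := (arrs s)(a := (arrs s a)(aval i s := aval e s))\<rparr>)"
| Seq: "exec c1 s t1 s1 \<Longrightarrow> exec c2 s1 t2 s2 \<Longrightarrow> exec (Seq c1 c2) s (t1 + t2) s2"
| IfTrue: "bval b s \<Longrightarrow> exec c1 s t s' \<Longrightarrow> exec (If b c1 c2) s (bcost b + t) s'"
| IfFalse: "\<not> bval b s \<Longrightarrow> exec c2 s t s' \<Longrightarrow> exec (If b c1 c2) s (bcost b + t) s'"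
| WhileFalse: "\<not> bval b s \<Longrightarrow> exec (While b c) s (bcost b) s"
| WhileTrue: "bval b s \<Longrightarrow> exec c s t1 s1 \<Longrightarrow> exec (While b c) s1 t2 s2 \<Longrightarrow>
    exec (While b c) s (bcost b + t1 + t2) s2"

inductive_cases SkipE: "exec Skip s t s'"
inductive_cases AssignE: "exec (Assign x e) s t s'"
inductive_cases StoreE: "exec (Store a i e) s t s'"
inductive_cases SeqE: "exec (Seq c1 c2) s t s'"
inductive_cases IfE: "exec (If b c1 c2) s t s'"
inductive_cases WhileE: "exec (While b c) s t s'"

lemma exec_deterministic:
  "exec c s t s' \<Longrightarrow> exec c s u s'' \<Longrightarrow> u = t \<and> s'' = s'"
proof (induction arbitrary: u s'' rule: exec.induct)
  case Skip
  then show ?case by (auto elim: SkipE)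
next
  case Assign
  then show ?case by (auto elim: AssignE)
next
  case Store
  then show ?case by (auto elim: StoreE)
next
  case Seq
  from Seq.prems show ?case by (rule SeqE) (use Seq.IH in blast)
next
  case IfTrue
  from IfTrue.prems show ?case by (rule IfE) (use IfTrue.hyps IfTrue.IH in blast)+
next
  case IfFalse
  from IfFalse.prems show ?case by (rule IfE) (use IfFalse.hyps IfFalse.IH in blast)+
next
  case WhileFalse
  from WhileFalse.prems show ?case by (rule WhileE) (use WhileFalse.hyps in blast)+
next
  case WhileTrue
  from WhileTrue.prems show ?case by (rule WhileE) (use WhileTrue.hyps WhileTrue.IH in blast)+
qed


section \<open>Fixed-parameter tractability\<close>

text \<open>Results are returned in variable 0.\<close>

definition computable :: "(nat \<Rightarrow> nat) \<Rightarrow> bool" where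
  "computable f \<longleftrightarrow>
     (\<exists>p. \<forall>d. \<exists>t s. exec p \<lparr>vars = (\<lambda>_. 0)(0 := int d), arrs = (\<lambda>_ _. 0)\<rparr> t s
                  \<and> vars s 0 = int (f d))"

text \<open>\<open>I\<close> is the set of admissible inputs, \<open>enc\<close> their representation as an initial store,
  \<open>sz\<close> and \<open>par\<close> the size and the parameter of an input, and \<open>Q\<close> the question to be decided.
  The program, the function \<open>f\<close> and the exponent do not depend on the input.\<close>

definition fixed_parameter_tractable ::
  "'i set \<Rightarrow> ('i \<Rightarrow> store) \<Rightarrow> ('i \<Rightarrow> nat) \<Rightarrow> ('i \<Rightarrow> nat) \<Rightarrow> ('i \<Rightarrow> bool) \<Rightarrow> bool" where
  "fixed_parameter_tractable I enc sz par Q \<longleftrightarrow>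
     (\<exists>f p c. computable f \<and>
        (\<forall>x\<in>I. \<exists>t s. exec p (enc x) t s \<and> t \<le> f (par x) * sz x ^ c
                    \<and> vars s 0 = (if Q x then 1 else 0)))"


section \<open>The inputs\<close>

type_synonym cf_input = "nat pair_pre_digraph \<times> nat set \<times> int"

text \<open>As usual for algorithmic inputs, the vertices are numbered \<open>0, \<dots>, n - 1\<close>. The predicate
  \<^const>\<open>Digraph_Component.connected\<close> includes that there is at least one vertex.\<close>

definition cf_inputs :: "cf_input set" where
  "cf_inputs = {(G, X, k). pair_graph G \<and> (\<exists>n. pverts G = {..<n}) \<and>
     Digraph_Component.connected (with_proj G) \<and> cluster_modulator G X}"

text \<open>The number \<open>n\<close> of vertices is in variable 0 and \<open>k\<close> in variable 1; array 0 holds the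
  indicator function of \<open>X\<close>, and array 1 the adjacency matrix, row by row. Everything else is 0.\<close>

definition encode_cf_input :: "cf_input \<Rightarrow> store" where
  "encode_cf_input = (\<lambda>(G, X, k). let n = card (pverts G) in
     \<lparr>vars = (\<lambda>_. 0)(0 := int n, 1 := k),
      arrs = (\<lambda>_ _. 0)
        (0 := (\<lambda>i. if i \<in> int ` X then 1 else 0),
         1 := (\<lambda>i. if i \<in> (\<lambda>(u, v). int (u * n + v)) ` parcs G then 1 else 0))\<rparr>)"

end

theory Submission
  imports Defs "HOL-Library.Nat_Bijection"
begin

text \<open>With \<open>k \<ge> 2 d + 3\<close> colors the answer is positive (except for open neighborhoods and a single vertex):
  the vertices of \<open>X\<close> and one neighbor of each get private colors, and three more colors mark at most
  two of the remaining vertices of each clique. For fewer colors, a dynamic program runs through \<open>X\<close> and then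
  through the cliques of \<open>G - X\<close>, coloring vertex by vertex. The type of a vertex is its neighborhood in
  \<open>X\<close>, together with its identity if it belongs to \<open>X\<close>. Whether a neighborhood has a unique color depends
  only on the number of vertices of each type and color, capped at 3, among all vertices and within a
  clique. So the number of states depends only on \<open>d\<close>.

  The algorithm is a term of a small functional language with bounded loops, which is compiled to the
  random access machine. The running time is polynomial in the largest number of iterations of a loop, and
  all loops have at most \<open>n + F d\<close> iterations.\<close>


section \<open>A language of bounded loops\<close>

text \<open>A vertex outside \<open>X\<close> has all its neighbors in \<open>X\<close> and in its
  own clique. So once \<open>X\<close> is colored, it can be judged as soon as its clique is
  complete, and the clique counters can then be erased; only the elements of \<open>X\<close>, whose
  neighbors are scattered over all cliques, have to wait until the end. Judging pairs of type and
  color instead of vertices is sound because members of a clique that agree in both satisfy the same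
  condition. The number of such pairs is \<open>2 ^ (2 * d) * k\<close>; the case distinction on
  \<open>k\<close> bounds it in terms of \<open>d\<close>. Its threshold adds up at most
  \<open>2 * d\<close> private colors, two marks and one color for all other vertices. The obstacle
  is a time bound for a concrete program with a computable parameter function. Time is therefore
  reduced to loop lengths. The subterms that work on states are wasteful searches, but their inputs
  are bounded in terms of \<open>d\<close>, so a generic computable bound suffices for them. Loops
  in which \<open>n\<close> occurs are bounded individually, as the generic bound need not be
  polynomial in \<open>n\<close>.\<close>

datatype trm =
    Num nat
  | Ref nat
  | Get nat trm
  | Plus trm trm
  | IfLess trm trm trm trm
  | Iterate nat nat trm trm trm

type_synonym env = "nat \<Rightarrow> nat"
type_synonym input = "nat \<Rightarrow> nat \<Rightarrow> nat"

text \<open>In \<open>Iterate x i l a t\<close> the accumulator \<open>x\<close> starts with the value of \<open>a\<close> and is replaced by the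
  value of \<open>t\<close> for each value of the counter \<open>i\<close> below \<open>l\<close>.\<close>

primrec ev :: "input \<Rightarrow> trm \<Rightarrow> env \<Rightarrow> nat" where
  "ev A (Num c) e = c"
| "ev A (Ref x) e = e x"
| "ev A (Get a t) e = A a (ev A t e)"
| "ev A (Plus s t) e = ev A s e + ev A t e"
| "ev A (IfLess s t u v) e = (if ev A s e < ev A t e then ev A u e else ev A v e)"
| "ev A (Iterate x i l a t) e =
     rec_nat (ev A a e) (\<lambda>j y. ev A t (e(x := y, i := j))) (ev A l e)"

text \<open>The constants are the costs of the commands emitted by \<open>compile\<close>. Each
  round of a loop pays 9 for the test and for updating accumulator and counter; the 7 pays for
  clearing the counter, for the last test, which fails, and for copying the result.\<close>

primrec cost :: "input \<Rightarrow> trm \<Rightarrow> env \<Rightarrow> nat" where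
  "cost A (Num c) e = 2"
| "cost A (Ref x) e = 2"
| "cost A (Get a t) e = cost A t e + 3"
| "cost A (Plus s t) e = cost A s e + cost A t e + 4"
| "cost A (IfLess s t u v) e = cost A s e + cost A t e + 3 +
     (if ev A s e < ev A t e then cost A u e else cost A v e)"
| "cost A (Iterate x i l a t) e = cost A l e + cost A a e + 7 +
     (\<Sum>j<ev A l e. cost A t (e(x := rec_nat (ev A a e) (\<lambda>j y. ev A t (e(x := y, i := j))) j, i := j)) + 9)"

primrec fv :: "trm \<Rightarrow> nat set" where
  "fv (Num c) = {}"
| "fv (Ref x) = {x}"
| "fv (Get a t) = fv t"
| "fv (Plus s t) = fv s \<union> fv t"
| "fv (IfLess s t u v) = fv s \<union> fv t \<union> fv u \<union> fv v"
| "fv (Iterate x i l a t) = fv l \<union> fv a \<union> (fv t - {x, i})"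

text \<open>Only executed loops count: of a conditional the branch taken is inspected, and a loop
  body is inspected for the accumulators that actually arise. This matters because the loops of the
  dynamic program are not bounded in terms of \<open>d\<close> when \<open>k\<close> is
  large.\<close>

primrec loops_bounded :: "input \<Rightarrow> nat \<Rightarrow> trm \<Rightarrow> env \<Rightarrow> bool" where
  "loops_bounded A B (Num c) e \<longleftrightarrow> True"
| "loops_bounded A B (Ref x) e \<longleftrightarrow> True"
| "loops_bounded A B (Get a t) e \<longleftrightarrow> loops_bounded A B t e"
| "loops_bounded A B (Plus s t) e \<longleftrightarrow> loops_bounded A B s e \<and> loops_bounded A B t e"
| "loops_bounded A B (IfLess s t u v) e \<longleftrightarrow> loops_bounded A B s e \<and> loops_bounded A B t e \<and>
     (if ev A s e < ev A t e then loops_bounded A B u e else loops_bounded A B v e)"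
| "loops_bounded A B (Iterate x i l a t) e \<longleftrightarrow>
     loops_bounded A B l e \<and> loops_bounded A B a e \<and> ev A l e \<le> B \<and>
     (\<forall>j<ev A l e. loops_bounded A B t
        (e(x := rec_nat (ev A a e) (\<lambda>j y. ev A t (e(x := y, i := j))) j, i := j)))"

lemma finite_fv [simp]: "finite (fv t)"
  by (induction t) auto

lemma ev_cong:
  assumes "\<And>x. x \<in> fv t \<Longrightarrow> e x = e' x"
  shows "ev A t e = ev A t e'"
  using assms
proof (induction t arbitrary: e e')
  case (Get a t)
  then show ?case by (metis ev.simps(3) fv.simps(3))
next
  case (Plus s t)
  then show ?case by (metis UnCI ev.simps(4) fv.simps(4))
next
  case (IfLess s t u v)
  from IfLess.IH(1)[of e e'] IfLess.IH(2)[of e e'] IfLess.IH(3)[of e e'] IfLess.IH(4)[of e e']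
    IfLess.prems show ?case by simp
next
  case (Iterate x i l a t)
  have "ev A l e = ev A l e'" "ev A a e = ev A a e'"
    using Iterate.prems by (auto intro!: Iterate.IH)
  moreover have "ev A t (e(x := y, i := j)) = ev A t (e'(x := y, i := j))" for y j
    using Iterate.prems by (intro Iterate.IH) auto
  ultimately show ?case by simp
qed auto

lemma loops_bounded_cong:
  assumes "\<And>x. x \<in> fv t \<Longrightarrow> e x = e' x"
  shows "loops_bounded A B t e = loops_bounded A B t e'"
  using assms
proof (induction t arbitrary: e e')
  case (Get a t)
  from Get.IH[of e e'] Get.prems show ?case by simp
next
  case (Plus s t)
  from Plus.IH(1)[of e e'] Plus.IH(2)[of e e'] Plus.prems show ?case by simp
next
  case (IfLess s t u v)
  have "ev A s e = ev A s e'" "ev A t e = ev A t e'"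
    by (rule ev_cong; use IfLess.prems in simp)+
  with IfLess.IH(1)[of e e'] IfLess.IH(2)[of e e'] IfLess.IH(3)[of e e'] IfLess.IH(4)[of e e']
    IfLess.prems show ?case by simp
next
  case (Iterate x i l a t)
  have "ev A l e = ev A l e'" "ev A a e = ev A a e'"
    by (rule ev_cong; use Iterate.prems in simp)+
  moreover have "loops_bounded A B l e = loops_bounded A B l e'"
    "loops_bounded A B a e = loops_bounded A B a e'"
    using Iterate.prems by (auto intro!: Iterate.IH)
  moreover have "loops_bounded A B t (e(x := y, i := j)) = loops_bounded A B t (e'(x := y, i := j))" for y j
    using Iterate.prems by (intro Iterate.IH) auto
  moreover have "ev A t (e(x := y, i := j)) = ev A t (e'(x := y, i := j))" for y j
    using Iterate.prems by (intro ev_cong) auto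
  ultimately show ?case by simp
qed auto

lemma ev_fun_upd [simp]: "x \<notin> fv t \<Longrightarrow> ev A t (e(x := y)) = ev A t e"
  by (rule ev_cong) auto

lemma loops_bounded_fun_upd [simp]:
  "x \<notin> fv t \<Longrightarrow> loops_bounded A B t (e(x := y)) = loops_bounded A B t e"
  by (rule loops_bounded_cong) auto

lemma loops_bounded_mono: "loops_bounded A B t e \<Longrightarrow> B \<le> B' \<Longrightarrow> loops_bounded A B' t e"
  by (induction t arbitrary: e) (auto split: if_splits)


section \<open>Compilation\<close>

text \<open>The registers from \<open>m\<close> on form a stack: the result goes to
  \<open>m\<close>, and everything below is preserved. A loop keeps its length in \<open>m\<close>,
  the accumulator in \<open>m + 1\<close> and the counter in \<open>m + 2\<close>, so its body works
  from \<open>m + 3\<close> on.\<close>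

primrec compile :: "(nat \<Rightarrow> nat) \<Rightarrow> nat \<Rightarrow> trm \<Rightarrow> com" where
  "compile \<rho> m (Num c) = Assign m (Const (int c))"
| "compile \<rho> m (Ref x) = Assign m (Var (\<rho> x))"
| "compile \<rho> m (Get a t) = Seq (compile \<rho> m t) (Assign m (Read a (Var m)))"
| "compile \<rho> m (Plus s t) = Seq (compile \<rho> m s) (Seq (compile \<rho> (m + 1) t)
     (Assign m (Add (Var m) (Var (m + 1)))))"
| "compile \<rho> m (IfLess s t u v) = Seq (compile \<rho> m s) (Seq (compile \<rho> (m + 1) t)
     (If (Less (Var m) (Var (m + 1))) (compile \<rho> m u) (compile \<rho> m v)))"
| "compile \<rho> m (Iterate x i l a t) = Seq (compile \<rho> m l) (Seq (compile \<rho> (m + 1) a)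
     (Seq (Assign (m + 2) (Const 0))
       (Seq (While (Less (Var (m + 2)) (Var m))
              (Seq (compile (\<rho>(x := m + 1, i := m + 2)) (m + 3) t)
                (Seq (Assign (m + 1) (Var (m + 3)))
                  (Assign (m + 2) (Add (Var (m + 2)) (Const 1))))))
         (Assign m (Var (m + 1))))))"

text \<open>As \<open>\<rho>\<close> is total and lands below \<open>m\<close>, infinitely many
  variables share a register. This is harmless, since binding a variable redirects
  \<open>\<rho>\<close> to a new register instead of overwriting the old one.\<close>

definition represents :: "(nat \<Rightarrow> nat) \<Rightarrow> nat \<Rightarrow> env \<Rightarrow> input \<Rightarrow> store \<Rightarrow> bool" where
  "represents \<rho> m e A s \<longleftrightarrow>
     (\<forall>x. \<rho> x < m \<and> vars s (\<rho> x) = int (e x)) \<and> (\<forall>a i. arrs s a (int i) = int (A a i))"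

definition yields :: "com \<Rightarrow> store \<Rightarrow> nat \<Rightarrow> nat \<Rightarrow> nat \<Rightarrow> bool" where
  "yields p s m v b \<longleftrightarrow> (\<exists>t s'. exec p s t s' \<and> t \<le> b \<and> vars s' m = int v \<and>
     (\<forall>r<m. vars s' r = vars s r) \<and> arrs s' = arrs s)"

lemma yieldsE:
  assumes "yields p s m v b"
  obtains t s' where "exec p s t s'" "t \<le> b" "vars s' m = int v" "\<And>r. r < m \<Longrightarrow> vars s' r = vars s r"
    "arrs s' = arrs s"
  using assms unfolding yields_def by blast

lemma represents_cong:
  assumes "represents \<rho> m e A s" "\<And>r. r < m \<Longrightarrow> vars s' r = vars s r" "arrs s' = arrs s" "m \<le> m'"
  shows "represents \<rho> m' e A s'"
  using assms unfolding represents_def by (metis order_less_le_trans)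

lemma exec_Assign: "s' = s\<lparr>vars := (vars s)(x := aval a s)\<rparr> \<Longrightarrow> t = acost a + 1 \<Longrightarrow>
    exec (Assign x a) s t s'"
  using exec.Assign by simp

lemma compile_yields:
  "represents \<rho> m e A s \<Longrightarrow> yields (compile \<rho> m t) s m (ev A t e) (cost A t e)"
proof (induction t arbitrary: \<rho> m e s)
  case (Num c)
  show ?case unfolding yields_def by (auto intro!: exI exec.Assign)
next
  case (Ref x)
  then show ?case unfolding yields_def represents_def by (auto intro!: exI exec.Assign)
next
  case (Get a t)
  obtain t1 s1 where 1: "exec (compile \<rho> m t) s t1 s1" "t1 \<le> cost A t e" "vars s1 m = int (ev A t e)"
    "\<And>r. r < m \<Longrightarrow> vars s1 r = vars s r" "arrs s1 = arrs s"
    using yieldsE[OF Get.IH[OF Get.prems]] by blast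
  have "arrs s1 a (vars s1 m) = int (A a (ev A t e))"
    using Get.prems 1 by (simp add: represents_def)
  then show ?case unfolding yields_def
    using 1 by (auto intro!: exI exec.Seq exec.Assign)
next
  case (Plus u v)
  obtain t1 s1 where 1: "exec (compile \<rho> m u) s t1 s1" "t1 \<le> cost A u e" "vars s1 m = int (ev A u e)"
    "\<And>r. r < m \<Longrightarrow> vars s1 r = vars s r" "arrs s1 = arrs s"
    using yieldsE[OF Plus.IH(1)[OF Plus.prems]] by blast
  have R: "represents \<rho> (m + 1) e A s1" by (rule represents_cong[OF Plus.prems]) (use 1 in auto)
  obtain t2 s2 where 2: "exec (compile \<rho> (m + 1) v) s1 t2 s2" "t2 \<le> cost A v e"
    "vars s2 (m + 1) = int (ev A v e)" "\<And>r. r < m + 1 \<Longrightarrow> vars s2 r = vars s1 r" "arrs s2 = arrs s1"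
    using yieldsE[OF Plus.IH(2)[OF R]] by blast
  show ?case unfolding yields_def compile.simps
    by (intro exI conjI, rule exec.Seq[OF 1(1)], rule exec.Seq[OF 2(1)], rule exec.Assign)
      (use 1 2 in auto)
next
  case (IfLess a b u v)
  obtain t1 s1 where 1: "exec (compile \<rho> m a) s t1 s1" "t1 \<le> cost A a e" "vars s1 m = int (ev A a e)"
    "\<And>r. r < m \<Longrightarrow> vars s1 r = vars s r" "arrs s1 = arrs s"
    using yieldsE[OF IfLess.IH(1)[OF IfLess.prems]] by blast
  have R: "represents \<rho> (m + 1) e A s1" by (rule represents_cong[OF IfLess.prems]) (use 1 in auto)
  obtain t2 s2 where 2: "exec (compile \<rho> (m + 1) b) s1 t2 s2" "t2 \<le> cost A b e"
    "vars s2 (m + 1) = int (ev A b e)" "\<And>r. r < m + 1 \<Longrightarrow> vars s2 r = vars s1 r" "arrs s2 = arrs s1"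
    using yieldsE[OF IfLess.IH(2)[OF R]] by blast
  have R2: "represents \<rho> m e A s2" by (rule represents_cong[OF IfLess.prems]) (use 1 2 in auto)
  let ?c = "ev A a e < ev A b e"
  let ?w = "if ?c then u else v"
  have "yields (compile \<rho> m ?w) s2 m (ev A ?w e) (cost A ?w e)"
    using IfLess.IH(3,4)[OF R2] by simp
  then obtain t3 s3 where 3: "exec (compile \<rho> m ?w) s2 t3 s3" "t3 \<le> cost A ?w e"
    "vars s3 m = int (ev A ?w e)" "\<And>r. r < m \<Longrightarrow> vars s3 r = vars s2 r" "arrs s3 = arrs s2"
    by (rule yieldsE) blast
  let ?b = "Less (Var m) (Var (m + 1))"
  have "bval ?b s2 = ?c" using 1 2 by simp
  with 3 have "exec (If ?b (compile \<rho> m u) (compile \<rho> m v)) s2 (bcost ?b + t3) s3"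
    by (cases ?c) (simp_all only: if_True if_False exec.IfTrue exec.IfFalse not_False_eq_True)
  from exec.Seq[OF 1(1) exec.Seq[OF 2(1) this]] show ?case unfolding yields_def compile.simps
    by - (intro exI conjI, assumption, use 1 2 3 in \<open>auto split: if_splits\<close>)
next
  case (Iterate x i l a t)
  obtain t1 s1 where 1: "exec (compile \<rho> m l) s t1 s1" "t1 \<le> cost A l e" "vars s1 m = int (ev A l e)"
    "\<And>r. r < m \<Longrightarrow> vars s1 r = vars s r" "arrs s1 = arrs s"
    using yieldsE[OF Iterate.IH(1)[OF Iterate.prems]] by blast
  have R: "represents \<rho> (m + 1) e A s1" by (rule represents_cong[OF Iterate.prems]) (use 1 in auto)
  obtain t2 s2 where 2: "exec (compile \<rho> (m + 1) a) s1 t2 s2" "t2 \<le> cost A a e"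
    "vars s2 (m + 1) = int (ev A a e)" "\<And>r. r < m + 1 \<Longrightarrow> vars s2 r = vars s1 r" "arrs s2 = arrs s1"
    using yieldsE[OF Iterate.IH(2)[OF R]] by blast
  define s3 where "s3 = s2\<lparr>vars := (vars s2)(m + 2 := 0)\<rparr>"
  have 3: "exec (Assign (m + 2) (Const 0)) s2 2 s3"
    by (rule exec_Assign) (auto simp: s3_def)
  define f where "f j = rec_nat (ev A a e) (\<lambda>j y. ev A t (e(x := y, i := j))) j" for j
  define N where "N = ev A l e"
  let ?\<rho> = "\<rho>(x := m + 1, i := m + 2)"
  let ?b = "Less (Var (m + 2)) (Var m)"
  let ?body = "Seq (compile ?\<rho> (m + 3) t) (Seq (Assign (m + 1) (Var (m + 3)))
                  (Assign (m + 2) (Add (Var (m + 2)) (Const 1))))"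
  \<comment> \<open>The start index is arbitrary so that the induction can run on the number of
    remaining rounds; the 3 pays for the last test.\<close>
  have loop: "\<exists>u s'. exec (While ?b ?body) s0 u s' \<and>
      u \<le> 3 + (\<Sum>j=j0..<N. cost A t (e(x := f j, i := j)) + 9) \<and>
      vars s' (m + 1) = int (f N) \<and> (\<forall>r<m. vars s' r = vars s r) \<and> arrs s' = arrs s"
    if "j0 \<le> N" "vars s0 m = int N" "vars s0 (m + 1) = int (f j0)" "vars s0 (m + 2) = int j0"
      "\<forall>r<m. vars s0 r = vars s r" "arrs s0 = arrs s" for j0 s0
    using that
  proof (induction "N - j0" arbitrary: j0 s0)
    case 0
    then have "j0 = N" by simp
    with 0 have "exec (While ?b ?body) s0 (bcost ?b) s0" by (intro exec.WhileFalse) auto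
    with 0 \<open>j0 = N\<close> show ?case by - (intro exI conjI, assumption, auto)
  next
    case (Suc c)
    then have "j0 < N" by simp
    have "represents ?\<rho> (m + 3) (e(x := f j0, i := j0)) A s0"
      using Suc.prems Iterate.prems by (auto simp: represents_def less_SucI intro: trans_less_add1)
    note Iterate.IH(3)[OF this]
    moreover have fS: "f (Suc j0) = ev A t (e(x := f j0, i := j0))" by (simp add: f_def)
    ultimately obtain u1 s4 where 4: "exec (compile ?\<rho> (m + 3) t) s0 u1 s4"
      "u1 \<le> cost A t (e(x := f j0, i := j0))" "vars s4 (m + 3) = int (f (Suc j0))"
      "\<And>r. r < m + 3 \<Longrightarrow> vars s4 r = vars s0 r" "arrs s4 = arrs s0"
      unfolding fS yields_def by blast
    define s5 where "s5 = s4\<lparr>vars := (vars s4)(m + 1 := int (f (Suc j0)), m + 2 := int (Suc j0))\<rparr>"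
    have 5: "exec (Seq (Assign (m + 1) (Var (m + 3))) (Assign (m + 2) (Add (Var (m + 2)) (Const 1)))) s4 6 s5"
      by (rule exec.Seq[of _ _ 2 "s4\<lparr>vars := (vars s4)(m + 1 := int (f (Suc j0)))\<rparr>" _ 4, simplified],
          rule exec_Assign, use 4 in simp, simp, rule exec_Assign)
        (use 4 Suc.prems in \<open>auto simp: s5_def add.commute\<close>)
    have "\<exists>u s'. exec (While ?b ?body) s5 u s' \<and>
      u \<le> 3 + (\<Sum>j=Suc j0..<N. cost A t (e(x := f j, i := j)) + 9) \<and>
      vars s' (m + 1) = int (f N) \<and> (\<forall>r<m. vars s' r = vars s r) \<and> arrs s' = arrs s"
      by (rule Suc.hyps(1)) (use Suc.hyps(2) \<open>j0 < N\<close> Suc.prems 4 in \<open>auto simp: s5_def\<close>)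
    then obtain u2 s6 where 6: "exec (While ?b ?body) s5 u2 s6"
      "u2 \<le> 3 + (\<Sum>j=Suc j0..<N. cost A t (e(x := f j, i := j)) + 9)"
      "vars s6 (m + 1) = int (f N)" "\<forall>r<m. vars s6 r = vars s r" "arrs s6 = arrs s" by blast
    have "bval ?b s0" using Suc.prems \<open>j0 < N\<close> by simp
    from exec.WhileTrue[OF this exec.Seq[OF 4(1) 5] 6(1)] show ?case
      by - (intro exI conjI, assumption, use 4 6 \<open>j0 < N\<close> in \<open>auto simp: sum.atLeast_Suc_lessThan\<close>)
  qed
  have "\<exists>u s'. exec (While ?b ?body) s3 u s' \<and>
      u \<le> 3 + (\<Sum>j=0..<N. cost A t (e(x := f j, i := j)) + 9) \<and>
      vars s' (m + 1) = int (f N) \<and> (\<forall>r<m. vars s' r = vars s r) \<and> arrs s' = arrs s"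
    by (rule loop) (use 1 2 in \<open>auto simp: s3_def f_def N_def\<close>)
  then obtain u s4 where 4: "exec (While ?b ?body) s3 u s4"
      "u \<le> 3 + (\<Sum>j=0..<N. cost A t (e(x := f j, i := j)) + 9)"
      "vars s4 (m + 1) = int (f N)" "\<forall>r<m. vars s4 r = vars s r" "arrs s4 = arrs s" by blast
  have 5: "exec (Assign m (Var (m + 1))) s4 2 (s4\<lparr>vars := (vars s4)(m := int (f N))\<rparr>)"
    by (rule exec_Assign) (use 4 in auto)
  from exec.Seq[OF 1(1) exec.Seq[OF 2(1) exec.Seq[OF 3 exec.Seq[OF 4(1) 5]]]] show ?case
    unfolding yields_def compile.simps
    by - (intro exI conjI, assumption, use 1 2 4 in \<open>auto simp: f_def N_def atLeast0LessThan\<close>)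
qed


section \<open>Running times\<close>

text \<open>The constants depend on the term only, so a term whose loops are bounded by
  \<open>n + F d\<close> runs in fixed-parameter time.\<close>

lemma poly_le_poly:
  assumes "a \<le> a'" "(x::nat) \<le> y" "p \<le> q" "1 \<le> y"
  shows "a * x ^ p \<le> a' * y ^ q"
proof -
  have "x ^ p \<le> y ^ p" using assms by (intro power_mono) auto
  also have "\<dots> \<le> y ^ q" using assms by (intro power_increasing) auto
  finally show ?thesis using assms by (intro mult_mono) auto
qed

lemma le_mult_one_le: "(1::nat) \<le> y \<Longrightarrow> c \<le> c * y"
  by simp

lemma cost_polynomial:
  "\<exists>K p. \<forall>A B e. loops_bounded A B t e \<longrightarrow> cost A t e \<le> K * (B + 1) ^ p"
proof (induction t)
  case (Num c)
  show ?case by (intro exI[of _ 2]) auto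
next
  case (Ref x)
  show ?case by (intro exI[of _ 2]) auto
next
  case (Get a t)
  then obtain K p where *: "\<forall>A B e. loops_bounded A B t e \<longrightarrow> cost A t e \<le> K * (B + 1) ^ p" by blast
  show ?case
  proof (intro exI allI impI)
    fix A B e assume "loops_bounded A B (Get a t) e"
    with * have "cost A t e \<le> K * (B + 1) ^ p" by simp
    then show "cost A (Get a t) e \<le> (K + 3) * (B + 1) ^ p"
      by (simp add: distrib_right add_mono)
  qed
next
  case (Plus u v)
  then obtain K p K' p' where
    *: "\<And>A B e. loops_bounded A B u e \<Longrightarrow> cost A u e \<le> K * (B + 1) ^ p"
    "\<And>A B e. loops_bounded A B v e \<Longrightarrow> cost A v e \<le> K' * (B + 1) ^ p'" by blast
  show ?case
  proof (intro exI allI impI)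
    fix A B e assume "loops_bounded A B (Plus u v) e"
    with * have 1: "cost A u e \<le> K * (B + 1) ^ p" and 2: "cost A v e \<le> K' * (B + 1) ^ p'" by auto
    let ?P = "(B + 1) ^ (p + p')"
    have "cost A (Plus u v) e \<le> K * ?P + K' * ?P + 4 * ?P"
      unfolding cost.simps
      by (intro add_mono order_trans[OF 1 poly_le_poly] order_trans[OF 2 poly_le_poly]) auto
    then show "cost A (Plus u v) e \<le> (K + K' + 4) * ?P" by (simp add: distrib_right)
  qed
next
  case (IfLess u v w z)
  then obtain K p K' p' L q L' q' where
    *: "\<And>A B e. loops_bounded A B u e \<Longrightarrow> cost A u e \<le> K * (B + 1) ^ p"
    "\<And>A B e. loops_bounded A B v e \<Longrightarrow> cost A v e \<le> K' * (B + 1) ^ p'"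
    "\<And>A B e. loops_bounded A B w e \<Longrightarrow> cost A w e \<le> L * (B + 1) ^ q"
    "\<And>A B e. loops_bounded A B z e \<Longrightarrow> cost A z e \<le> L' * (B + 1) ^ q'" by metis
  show ?case
  proof (intro exI allI impI)
    fix A B e assume b: "loops_bounded A B (IfLess u v w z) e"
    let ?P = "(B + 1) ^ (p + p' + q + q')"
    have 1: "cost A u e \<le> K * ?P"
      by (rule order_trans[OF *(1) poly_le_poly]) (use b in auto)
    have 2: "cost A v e \<le> K' * ?P"
      by (rule order_trans[OF *(2) poly_le_poly]) (use b in auto)
    have 3: "cost A w e \<le> L * ?P" if "ev A u e < ev A v e"
      by (rule order_trans[OF *(3) poly_le_poly]) (use b that in auto)
    have 4: "cost A z e \<le> L' * ?P" if "\<not> ev A u e < ev A v e"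
      by (rule order_trans[OF *(4) poly_le_poly]) (use b that in auto)
    have "cost A (IfLess u v w z) e \<le> K * ?P + K' * ?P + 3 * ?P + (L * ?P + L' * ?P)"
      unfolding cost.simps using 3 4 by (intro add_mono 1 2) (auto simp: trans_le_add1 trans_le_add2)
    then show "cost A (IfLess u v w z) e \<le> (K + K' + 3 + L + L') * ?P" by (simp add: distrib_right)
  qed
next
  case (Iterate x i u v w)
  then obtain K p K' p' L q where
    *: "\<And>A B e. loops_bounded A B u e \<Longrightarrow> cost A u e \<le> K * (B + 1) ^ p"
    "\<And>A B e. loops_bounded A B v e \<Longrightarrow> cost A v e \<le> K' * (B + 1) ^ p'"
    "\<And>A B e. loops_bounded A B w e \<Longrightarrow> cost A w e \<le> L * (B + 1) ^ q" by metis
  show ?case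
  proof (intro exI allI impI)
    fix A B e assume b: "loops_bounded A B (Iterate x i u v w) e"
    \<comment> \<open>Adding the exponents makes \<open>?P\<close> dominate the bounds of all
      subterms; the extra 1 accounts for the number of rounds, at most \<open>B\<close>.\<close>
    let ?P = "(B + 1) ^ (p + p' + q + 1)"
    define f where "f j = rec_nat (ev A v e) (\<lambda>j y. ev A w (e(x := y, i := j))) j" for j
    have 1: "cost A u e \<le> K * ?P"
      by (rule order_trans[OF *(1) poly_le_poly]) (use b in auto)
    have 2: "cost A v e \<le> K' * ?P"
      by (rule order_trans[OF *(2) poly_le_poly]) (use b in auto)
    have 3: "cost A w (e(x := f j, i := j)) + 9 \<le> (L + 9) * (B + 1) ^ q" if "j < ev A u e" for j
    proof -
      have "cost A w (e(x := f j, i := j)) \<le> L * (B + 1) ^ q"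
        by (rule *(3)) (use b that in \<open>auto simp: f_def\<close>)
      then show ?thesis by (simp add: distrib_right add_mono)
    qed
    have "(\<Sum>j<ev A u e. cost A w (e(x := f j, i := j)) + 9) \<le> (\<Sum>j<ev A u e. (L + 9) * (B + 1) ^ q)"
      by (intro sum_mono 3) auto
    also have "\<dots> = ev A u e * ((L + 9) * (B + 1) ^ q)" by simp
    also have "\<dots> \<le> (B + 1) * ((L + 9) * (B + 1) ^ q)" using b by (intro mult_right_mono) auto
    also have "\<dots> = (L + 9) * (B + 1) ^ (q + 1)" by (simp add: algebra_simps)
    also have "\<dots> \<le> (L + 9) * ?P" by (rule poly_le_poly) auto
    finally have "cost A (Iterate x i u v w) e \<le> K * ?P + K' * ?P + 7 * ?P + (L + 9) * ?P"
      unfolding cost.simps f_def by (intro add_mono 1 2 le_mult_one_le[OF one_le_power] order_refl) auto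
    then show "cost A (Iterate x i u v w) e \<le> (K + K' + 7 + (L + 9)) * ?P"
      by (simp only: distrib_right)
  qed
qed

text \<open>Unlike \<open>cost\<close>, this majorant depends only on a common bound of the free variables (for input arrays
  with entries 0 and 1) and is itself definable by a term, hence computable.\<close>

primrec growth :: "trm \<Rightarrow> nat \<Rightarrow> nat" where
  "growth (Num c) b = c"
| "growth (Ref x) b = b"
| "growth (Get a t) b = growth t b + 1"
| "growth (Plus s t) b = growth s b + growth t b"
| "growth (IfLess s t u v) b = growth s b + growth t b + growth u b + growth v b"
| "growth (Iterate x i l a t) b =
     ((\<lambda>y. growth t y + y) ^^ growth l b) (growth a b + growth l b + b)"

lemma funpow_inflationary:
  assumes "\<And>y. y \<le> g y" "m \<le> n"
  shows "(g ^^ m) (x::nat) \<le> (g ^^ n) x"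
  using assms(2) by (induction rule: dec_induct) (auto intro: order_trans assms(1))

lemma funpow_mono2_nat:
  assumes "mono g" "\<And>y. y \<le> g y" "m \<le> n" "x \<le> y"
  shows "(g ^^ m) (x::nat) \<le> (g ^^ n) y"
  using funpow_inflationary[of g m n x] funpow_mono[OF assms(1,4), of n] assms by auto

lemma growth_mono: "b \<le> b' \<Longrightarrow> growth t b \<le> growth t b'"
proof (induction t arbitrary: b b')
  case (Iterate x i l a t)
  then show ?case unfolding growth.simps
    by (intro funpow_mono2_nat) (auto intro!: monoI add_mono)
qed (auto intro!: add_mono)

text \<open>Values and loop lengths are bounded together, as the length of a loop is a value and the
  value of a loop depends on its length.\<close>

lemma growth_bounds:
  assumes "\<And>x. x \<in> fv t \<Longrightarrow> e x \<le> b" and A: "\<And>a i. A a i \<le> 1"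
  shows "ev A t e \<le> growth t b \<and> loops_bounded A (growth t b) t e"
  using assms(1)
proof (induction t arbitrary: e b)
  case (Get a t)
  from Get.IH[of e b] Get.prems A show ?case by (auto intro: loops_bounded_mono order_trans)
next
  case (Plus u v)
  from Plus.IH(1)[of e b] Plus.IH(2)[of e b] Plus.prems show ?case
    by (auto intro: loops_bounded_mono)
next
  case (IfLess u v w z)
  from IfLess.IH(1)[of e b] IfLess.IH(2)[of e b] IfLess.IH(3)[of e b] IfLess.IH(4)[of e b]
    IfLess.prems show ?case
    by (auto intro: loops_bounded_mono)
next
  case (Iterate x i l a t)
  define f where "f j = rec_nat (ev A a e) (\<lambda>j y. ev A t (e(x := y, i := j))) j" for j
  \<comment> \<open>\<open>g\<close> bounds the effect of one round, and \<open>c\<close> dominates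
    the initial accumulator, the counters and the free variables. The summand \<open>y\<close> makes
    \<open>g\<close> inflationary, so that \<open>c\<close> stays below all iterates and fewer than
    \<open>growth l b\<close> rounds do no harm.\<close>
  define g where "g y = growth t y + y" for y
  define c where "c = growth a b + growth l b + b"
  have g: "mono g" "\<And>y. y \<le> g y" by (auto simp: g_def intro!: monoI add_mono growth_mono)
  have l: "ev A l e \<le> growth l b" "loops_bounded A (growth l b) l e"
    using Iterate.IH(1)[of e b] Iterate.prems by auto
  have a: "ev A a e \<le> growth a b" "loops_bounded A (growth a b) a e"
    using Iterate.IH(2)[of e b] Iterate.prems by auto
  have G: "growth (Iterate x i l a t) b = (g ^^ growth l b) c" by (simp add: g_def[abs_def] c_def)
  have c: "c \<le> (g ^^ j) c" for j using funpow_inflationary[of g 0 j c] g by simp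
  have step: "ev A t (e(x := f j, i := j)) \<le> (g ^^ Suc j) c \<and>
      loops_bounded A ((g ^^ Suc j) c) t (e(x := f j, i := j))"
    if "f j \<le> (g ^^ j) c" "j < growth l b" for j
  proof -
    have "ev A t (e(x := f j, i := j)) \<le> growth t ((g ^^ j) c) \<and>
      loops_bounded A (growth t ((g ^^ j) c)) t (e(x := f j, i := j))"
    proof (rule Iterate.IH(3))
      fix y assume "y \<in> fv t"
      then show "(e(x := f j, i := j)) y \<le> (g ^^ j) c"
        using that Iterate.prems[of y] c[of j] by (auto simp: c_def)
    qed
    moreover have "growth t ((g ^^ j) c) \<le> (g ^^ Suc j) c" by (simp add: g_def)
    ultimately show ?thesis using loops_bounded_mono order_trans by blast
  qed
  have f: "f j \<le> (g ^^ j) c" if "j \<le> growth l b" for j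
    using that
  proof (induction j)
    case 0
    then show ?case using a by (simp add: f_def c_def)
  next
    case (Suc j)
    then show ?case using step[of j] by (simp add: f_def)
  qed
  have up: "(g ^^ j) c \<le> growth (Iterate x i l a t) b" if "j \<le> growth l b" for j
    unfolding G by (rule funpow_inflationary) (use g that in auto)
  have "loops_bounded A (growth (Iterate x i l a t) b) t (e(x := f j, i := j))" if "j < ev A l e" for j
    using step[OF f, of j] up[of "Suc j"] that l loops_bounded_mono by (meson Suc_leI order_less_le_trans less_imp_le_nat)
  moreover have "c \<le> growth (Iterate x i l a t) b" using up[of 0] by simp
  moreover have "ev A (Iterate x i l a t) e \<le> growth (Iterate x i l a t) b"
    using f[of "ev A l e"] up[of "ev A l e"] l(1) by (auto simp: f_def)
  ultimately show ?case using l a unfolding loops_bounded.simps f_def[symmetric]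
    by (auto simp: c_def simp del: growth.simps ev.simps intro: loops_bounded_mono)
qed auto


section \<open>Computable functions\<close>

text \<open>A sufficient condition for computability that has better closure properties than machine
  programs: terms can be nested without bookkeeping of registers.\<close>

definition definable :: "(nat \<Rightarrow> nat) \<Rightarrow> bool" where
  "definable f \<longleftrightarrow> (\<exists>t. \<forall>A e. ev A t e = f (e 0))"

lemma definable_const: "definable (\<lambda>_. c)"
  unfolding definable_def by (rule exI[of _ "Num c"]) simp

lemma definable_id: "definable (\<lambda>b. b)"
  unfolding definable_def by (rule exI[of _ "Ref 0"]) simp

lemma definable_add: "definable f \<Longrightarrow> definable g \<Longrightarrow> definable (\<lambda>b. f b + g b)"
  unfolding definable_def by (metis ev.simps(4))

lemma definable_funpow:
  assumes "definable f" "definable l" "definable a"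
  shows "definable (\<lambda>b. (f ^^ l b) (a b))"
proof -
  from assms obtain tf tl ta where t: "\<forall>A e. ev A tf e = f (e 0)" "\<forall>A e. ev A tl e = l (e 0)"
    "\<forall>A e. ev A ta e = a (e 0)" unfolding definable_def by blast
  have "rec_nat x (\<lambda>j. f) m = (f ^^ m) x" for m x by (induction m) auto
  with t have "\<forall>A e. ev A (Iterate 0 1 tl ta tf) e = (f ^^ l (e 0)) (a (e 0))" by simp
  then show ?thesis unfolding definable_def by blast
qed

text \<open>Composition is a single round of iteration started at \<open>g b\<close>, which avoids
  substitution into terms.\<close>

lemma definable_comp: "definable f \<Longrightarrow> definable g \<Longrightarrow> definable (\<lambda>b. f (g b))"
  using definable_funpow[of f "\<lambda>_. 1" g] definable_const[of 1] by simp

lemma definable_pow2: "definable f \<Longrightarrow> definable (\<lambda>b. 2 ^ f b)"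
proof -
  have "((\<lambda>x. x + x) ^^ m) 1 = (2::nat) ^ m" for m by (induction m) auto
  then show "definable f \<Longrightarrow> definable (\<lambda>b. 2 ^ f b)"
    using definable_funpow[OF definable_add[OF definable_id definable_id] _ definable_const[of 1]]
    by simp
qed

lemma definable_mult: 
  assumes "definable f" "definable g"
  shows "definable (\<lambda>b. f b * g b)"
proof -
  from assms obtain s t where t: "\<forall>A e. ev A s e = f (e 0)" "\<forall>A e. ev A t e = g (e 0)"
    unfolding definable_def by blast
  have *: "rec_nat 0 (\<lambda>j y. y + x) m = m * x" for x m :: nat by (induction m) auto
  have "\<forall>A e. ev A (Iterate 1 2 s (Num 0) (Plus (Ref 1) t)) e = f (e 0) * g (e 0)"
    using * t by simp
  then show ?thesis unfolding definable_def by blast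
qed

lemma definable_power: "definable f \<Longrightarrow> definable (\<lambda>b. f b ^ c)"
  by (induction c) (auto intro: definable_const definable_mult)

lemma definable_growth: "definable (growth t)"
  by (induction t)
    (subst ext[OF growth.simps(1)] ext[OF growth.simps(2)] ext[OF growth.simps(3)]
      ext[OF growth.simps(4)] ext[OF growth.simps(5)] ext[OF growth.simps(6)],
      intro definable_const definable_id definable_add definable_funpow; assumption)+

lemma definable_computable:
  assumes "definable f"
  shows "computable f"
proof -
  from assms obtain t where t: "\<And>A e. ev A t e = f (e 0)" unfolding definable_def by blast
  define \<rho> :: "nat \<Rightarrow> nat" where "\<rho> x = (if x = 0 then 0 else 1)" for x
  show ?thesis unfolding computable_def
  proof (intro exI[of _ "Seq (compile \<rho> 2 t) (Assign 0 (Var 2))"] allI)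
    fix d
    let ?s = "\<lparr>vars = (\<lambda>_. 0)(0 := int d), arrs = (\<lambda>_ _. 0)\<rparr>"
    have "represents \<rho> 2 ((\<lambda>_. 0)(0 := d)) (\<lambda>_ _. 0) ?s"
      by (auto simp: represents_def \<rho>_def)
    note compile_yields[OF this, of t]
    moreover have "ev (\<lambda>_ _. 0) t ((\<lambda>_. 0)(0 := d)) = f d" by (simp add: t)
    ultimately obtain u s where
      "exec (compile \<rho> 2 t) ?s u s" "vars s 2 = int (f d)"
      by (metis yieldsE)
    then show "\<exists>u s. exec (Seq (compile \<rho> 2 t) (Assign 0 (Var 2))) ?s u s \<and> vars s 0 = int (f d)"
      by (auto intro!: exI exec.Seq exec.Assign)
  qed
qed

section \<open>Capped counting\<close>

text \<open>If some summand exceeds the cap, both totals reach it. Hence capped counts of different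
  types can be added and still determine the capped total.\<close>

lemma min_sum_min:
  "min m (\<Sum>i\<in>I. min m (f i)) = min m (\<Sum>i\<in>I. f i :: nat)"
proof (induction I rule: infinite_finite_induct)
  case (insert x F)
  then show ?case by (auto simp: min_def split: if_splits)
qed auto

lemma sum_card_fibers:
  assumes "finite D" "finite T"
  shows "(\<Sum>t\<in>T. card {v \<in> D. f v = t \<and> P v}) = card {v \<in> D. f v \<in> T \<and> P v}"
proof -
  have "card (\<Union>t\<in>T. {v \<in> D. f v = t \<and> P v}) = (\<Sum>t\<in>T. card {v \<in> D. f v = t \<and> P v})"
    using assms by (intro card_UN_disjoint) auto
  moreover have "(\<Union>t\<in>T. {v \<in> D. f v = t \<and> P v}) = {v \<in> D. f v \<in> T \<and> P v}" by auto
  ultimately show ?thesis by simp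
qed

lemma set_encode_less_power:
  assumes "finite A"
  shows "set_encode A < 2 ^ m \<longleftrightarrow> A \<subseteq> {..<m}"
proof
  assume less: "set_encode A < 2 ^ m"
  show "A \<subseteq> {..<m}"
  proof
    fix i assume "i \<in> A"
    then have "2 ^ i \<le> set_encode A"
      unfolding set_encode_def using assms by (intro member_le_sum) auto
    from this less have "(2::nat) ^ i < 2 ^ m" by (rule le_less_trans)
    then show "i \<in> {..<m}" by simp
  qed
next
  assume "A \<subseteq> {..<m}"
  then have "set_encode A \<le> set_encode {..<m}"
    unfolding set_encode_def by (intro sum_mono2) auto
  also have "set_encode {..<m} = 2 ^ m - 1"
    using sum_power2[of m] by (simp add: set_encode_def lessThan_atLeast0)
  also have "\<dots> < 2 ^ m" by simp
  finally show "set_encode A < 2 ^ m" .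
qed

text \<open>Increments a unary counter stored at \<open>q\<close>, \<open>q + 1\<close>,
  \<open>q + 2\<close>; a full counter stays as it is, since \<open>q + 2\<close> is then inserted
  again.\<close>

definition raise :: "nat \<Rightarrow> nat set \<Rightarrow> nat set" where
  "raise q A = insert (if q \<notin> A then q else if q + 1 \<notin> A then q + 1 else q + 2) A"

definition bump :: "nat \<Rightarrow> nat \<Rightarrow> nat" where
  "bump q j = set_encode (raise q (set_decode j))"

lemma finite_raise [simp]: "finite A \<Longrightarrow> finite (raise q A)"
  by (simp add: raise_def)

lemma raise_append:
  assumes "A \<subseteq> {..<m}" "q + 2 < m"
  shows "raise q (A \<union> (+) m ` B) = raise q A \<union> (+) m ` B"
  using assms by (auto simp: raise_def)

lemma raise_append_shift:
  assumes "A \<subseteq> {..<m}"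
  shows "raise (m + q) (A \<union> (+) m ` B) = A \<union> (+) m ` raise q B"
proof -
  have "m + i \<in> A \<union> (+) m ` B \<longleftrightarrow> i \<in> B" for i using assms by auto
  from this[of q] this[of "q + 1"] show ?thesis by (auto simp: raise_def add.assoc)
qed

text \<open>A multiplicity capped at 3 is written in unary on the positions \<open>3 p\<close>, \<open>3 p + 1\<close>, \<open>3 p + 2\<close>. The cap
  must exceed 2, as for open neighborhoods one subtracts the vertex itself before testing for 1.\<close>

definition unary :: "(nat \<Rightarrow> nat) \<Rightarrow> nat set" where
  "unary h = {q. q mod 3 < h (q div 3)}"

lemma mem_unary: "i < 3 \<Longrightarrow> 3 * p + i \<in> unary h \<longleftrightarrow> i < h p"
  by (simp add: unary_def)

text \<open>Beyond the cap both sides leave the set unchanged. So the capped record can be updated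
  without knowing the true multiplicity.\<close>

lemma unary_raise:
  "unary (h(p := Suc (h p))) = raise (3 * p) (unary h)"
proof (intro set_eqI)
  fix q :: nat
  obtain p' i where q: "q = 3 * p' + i" and i: "i < 3"
    by (rule that[of "q div 3" "q mod 3"]) auto
  have eq: "q = 3 * p + j \<longleftrightarrow> p' = p \<and> i = j" if "j < 3" for j
    using q i that by presburger
  have "q \<in> raise (3 * p) (unary h) \<longleftrightarrow>
    q = 3 * p + (if h p = 0 then 0 else if h p = 1 then 1 else 2) \<or> i < h p'"
    using mem_unary[of 0 p h] mem_unary[of 1 p h] mem_unary[OF i, of p' h]
    by (auto simp: raise_def q)
  also have "\<dots> \<longleftrightarrow> i < (h(p := Suc (h p))) p'"
    using i by (subst eq) auto
  finally show "q \<in> unary (h(p := Suc (h p))) \<longleftrightarrow> q \<in> raise (3 * p) (unary h)"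
    using mem_unary[OF i] q by simp
qed

lemma count_unary: "(\<Sum>i<3. if 3 * p + i \<in> unary h then 1 else 0) = min 3 (h p)"
proof -
  have "(\<Sum>i<3. if 3 * p + i \<in> unary h then 1 else 0) = (\<Sum>i<(3::nat). if i < h p then 1 else 0 :: nat)"
    by (intro sum.cong) (auto simp: mem_unary)
  also have "\<dots> = card ({..<3} \<inter> {..<h p})" by (simp add: sum.If_cases lessThan_def)
  also have "{..<3} \<inter> {..<h p} = {..<min 3 (h p)}" by auto
  finally show ?thesis by simp
qed


section \<open>The dynamic program\<close>

locale cluster_instance =
  fixes n :: nat and X :: "nat set" and E :: "(nat \<times> nat) set" and cn :: bool and k :: nat
  assumes X_sub: "X \<subseteq> {..<n}" and E_sub: "E \<subseteq> {..<n} \<times> {..<n}"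
    and E_sym: "(u, v) \<in> E \<Longrightarrow> (v, u) \<in> E" and E_irrefl: "(v, v) \<notin> E"
    and E_trans: "(u, v) \<in> E \<Longrightarrow> (v, w) \<in> E \<Longrightarrow> u \<notin> X \<Longrightarrow> v \<notin> X \<Longrightarrow> w \<notin> X \<Longrightarrow> u \<noteq> w \<Longrightarrow> (u, w) \<in> E"
begin

definition d :: nat where "d = card X"
definition rank :: "nat \<Rightarrow> nat" where "rank x = card {y \<in> X. y < x}"
definition nb :: "nat \<Rightarrow> nat set" where "nb v = {u. (v, u) \<in> E \<or> cn \<and> u = v}"
definition uniq :: "(nat \<Rightarrow> nat) \<Rightarrow> nat \<Rightarrow> bool" where
  "uniq C v \<longleftrightarrow> (\<exists>c. card {u \<in> nb v. C u = c} = 1)"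

text \<open>Bit \<open>r < d\<close> of a type stands for adjacency to the element of \<open>X\<close> of rank \<open>r\<close>, bit \<open>d + r\<close> for being
  that element.\<close>

definition vtype :: "nat \<Rightarrow> nat" where
  "vtype v = set_encode (rank ` (X \<inter> nb v) \<union> (if v \<in> X then {d + rank v} else {}))"

text \<open>The number of keys \<open>\<tau> * k + c\<close> for types
  \<open>\<tau> < 2 ^ (2 * d)\<close> and colors \<open>c < k\<close>.\<close>

definition L :: nat where "L = 2 ^ (2 * d) * k"

text \<open>A state is the code of a set: the positions below \<open>3 L\<close> count the pairs of type and color among all
  processed vertices, the positions from \<open>3 L\<close> on among those of the current clique.\<close>

definition vstep :: "nat \<Rightarrow> nat set \<Rightarrow> nat set" where
  "vstep \<tau> S = {bump (3 * L + 3 * (\<tau> * k + c)) (bump (3 * (\<tau> * k + c)) j) | j c. j \<in> S \<and> c < k}"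

definition cnt :: "nat \<Rightarrow> nat \<Rightarrow> nat \<Rightarrow> nat \<Rightarrow> nat" where
  "cnt j b \<sigma> c = (\<Sum>i<3. if b + (3 * (\<sigma> * k + c) + i) \<in> set_decode j then 1 else 0)"

text \<open>For a bit \<open>r < d\<close> this counts the processed vertices of color
  \<open>c\<close> whose \<open>nb\<close> contains the element of \<open>X\<close> of rank
  \<open>r\<close>; for a bit \<open>d + r\<close> it tells whether that element itself has color
  \<open>c\<close>. The summands are capped one by one, so a count is reliable only up to the
  cap.\<close>

definition seen :: "nat \<Rightarrow> nat \<Rightarrow> nat \<Rightarrow> nat" where
  "seen j r c = (\<Sum>\<sigma><2 ^ (2 * d). if r \<in> set_decode \<sigma> then cnt j 0 \<sigma> c else 0)"

text \<open>Types below \<open>2 ^ d\<close> have no identity bit, i.e. they belong to vertices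
  outside \<open>X\<close>.\<close>

definition in_clique :: "nat \<Rightarrow> nat \<Rightarrow> nat" where
  "in_clique j c = (\<Sum>\<sigma><2 ^ d. cnt j (3 * L) \<sigma> c)"

text \<open>The right-hand side 2 accounts for the vertex itself, which is counted in its clique but does not
  belong to its open neighborhood.\<close>

definition clique_ok :: "nat \<Rightarrow> bool" where
  "clique_ok j \<longleftrightarrow> (\<forall>\<tau><2 ^ d. \<forall>c'<k. 3 * L + 3 * (\<tau> * k + c') \<in> set_decode j \<longrightarrow>
     (\<exists>c<k. in_clique j c + (\<Sum>r<d. if r \<in> set_decode \<tau> then seen j (d + r) c else 0) =
        1 + (if cn \<or> c \<noteq> c' then 0 else 1)))"

definition modulator_ok :: "nat \<Rightarrow> bool" where
  "modulator_ok j \<longleftrightarrow> (\<forall>r<d. \<exists>c<k. seen j r c = 1)"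

text \<open>The clique counters can be erased after the test, because no vertex of another clique is
  adjacent to this one.\<close>

definition estep :: "nat set \<Rightarrow> nat set" where
  "estep S = {set_encode (set_decode j \<inter> {..<3 * L}) | j. j \<in> S \<and> clique_ok j}"

text \<open>\<open>estep\<close> follows every block, also an empty one; with no clique counter set,
  its test is void.\<close>

definition phase :: "(nat \<Rightarrow> nat \<Rightarrow> bool) \<Rightarrow> nat set \<Rightarrow> nat set" where
  "phase blk S = rec_nat S (\<lambda>u S. estep
     (rec_nat S (\<lambda>v S. if blk u v then vstep (vtype v) S else S) n)) n"

definition modulator_block :: "nat \<Rightarrow> nat \<Rightarrow> bool" where
  "modulator_block u v \<longleftrightarrow> u \<in> X \<and> v = u"

text \<open>Each clique of the cluster graph is processed when \<open>u\<close> reaches its smallest vertex.\<close>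

definition clique_block :: "nat \<Rightarrow> nat \<Rightarrow> bool" where
  "clique_block u v \<longleftrightarrow> u \<notin> X \<and> v \<notin> X \<and> (u = v \<or> (u, v) \<in> E) \<and>
     (\<forall>w<u. w \<in> X \<or> w \<noteq> v \<and> (w, v) \<notin> E)"

definition accepted :: bool where
  "accepted \<longleftrightarrow> (\<exists>j\<in>phase clique_block (phase modulator_block {0}). modulator_ok j)"

section \<open>Ranks, types and keys\<close>

lemma finite_X [simp]: "finite X"
  using X_sub finite_subset by blast

lemma nb_sub: "v < n \<Longrightarrow> nb v \<subseteq> {..<n}"
  using E_sub by (auto simp: nb_def)

lemma finite_nb: "v < n \<Longrightarrow> finite (nb v)"
  using nb_sub finite_subset by blast

lemma nb_sym: "u \<in> nb v \<longleftrightarrow> v \<in> nb u"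
  using E_sym by (auto simp: nb_def)

lemma bij_rank: "bij_betw rank X {..<d}"
proof -
  have mono: "rank x < rank y" if "x \<in> X" "y \<in> X" "x < y" for x y
    unfolding rank_def by (rule psubset_card_mono) (use that in auto)
  then have inj: "inj_on rank X" by (metis (no_types, lifting) inj_onI less_irrefl linorder_neqE_nat)
  have "rank x < d" if "x \<in> X" for x
    unfolding rank_def d_def by (rule psubset_card_mono) (use that in auto)
  then have "rank ` X \<subseteq> {..<d}" by auto
  moreover have "card (rank ` X) = card {..<d}" using inj by (simp add: card_image d_def)
  ultimately have "rank ` X = {..<d}" by (intro card_subset_eq) auto
  with inj show ?thesis by (simp add: bij_betw_def)
qed

lemma rank_less: "x \<in> X \<Longrightarrow> rank x < d"
  using bij_rank by (auto simp: bij_betw_def)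

lemma rank_eq_iff: "x \<in> X \<Longrightarrow> y \<in> X \<Longrightarrow> rank x = rank y \<longleftrightarrow> x = y"
  using bij_rank by (auto simp: bij_betw_def inj_on_def)

lemma decode_vtype: "set_decode (vtype v) = rank ` (X \<inter> nb v) \<union> (if v \<in> X then {d + rank v} else {})"
  by (simp add: vtype_def)

lemma neighbor_in_vtype: "x \<in> X \<Longrightarrow> rank x \<in> set_decode (vtype v) \<longleftrightarrow> x \<in> nb v"
  using rank_less[of x] by (auto simp: decode_vtype rank_eq_iff)

lemma identity_in_vtype: "x \<in> X \<Longrightarrow> d + rank x \<in> set_decode (vtype v) \<longleftrightarrow> v = x"
proof -
  have "d + rank x \<notin> rank ` (X \<inter> nb v)" using rank_less by fastforce
  then show "x \<in> X \<Longrightarrow> d + rank x \<in> set_decode (vtype v) \<longleftrightarrow> v = x"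
    by (auto simp: decode_vtype rank_eq_iff)
qed

lemma vtype_less: "vtype v < 2 ^ (2 * d)"
  unfolding vtype_def by (subst set_encode_less_power) (auto dest!: rank_less)

lemma less_power_double: "\<tau> < 2 ^ d \<Longrightarrow> \<tau> < (2::nat) ^ (2 * d)"
  by (erule less_le_trans) (simp add: power_increasing)

lemma vtype_less_iff: "vtype v < 2 ^ d \<longleftrightarrow> v \<notin> X"
  unfolding vtype_def by (subst set_encode_less_power) (auto dest!: rank_less)

lemma key_less: "\<tau> < 2 ^ (2 * d) \<Longrightarrow> c < k \<Longrightarrow> \<tau> * k + c < L"
proof -
  assume "\<tau> < 2 ^ (2 * d)" "c < k"
  then have "\<tau> * k + c < (\<tau> + 1) * k" by simp
  also have "\<dots> \<le> L" unfolding L_def using \<open>\<tau> < _\<close> by (intro mult_right_mono) auto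
  finally show ?thesis .
qed

section \<open>States of partial colorings\<close>

definition mult :: "(nat \<Rightarrow> nat) \<Rightarrow> nat set \<Rightarrow> nat \<Rightarrow> nat" where
  "mult C A p = card {v \<in> A. vtype v * k + C v = p}"

definition state :: "(nat \<Rightarrow> nat) \<Rightarrow> nat set \<Rightarrow> nat set \<Rightarrow> nat" where
  "state C D B = set_encode (unary (mult C D) \<union> (+) (3 * L) ` unary (mult C B))"

definition colors :: "nat set \<Rightarrow> (nat \<Rightarrow> nat) set" where
  "colors D = D \<rightarrow> {..<k}"

text \<open>The intended content of the table: \<open>D\<close> is processed, \<open>B\<close> is
  the current block, and the vertices of \<open>F\<close> have passed their test.\<close>

definition reach :: "nat set \<Rightarrow> nat set \<Rightarrow> nat set \<Rightarrow> nat set" where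
  "reach D B F = {state C D B | C. C \<in> colors D \<and> (\<forall>w\<in>F. uniq C w)}"

lemma unary_sub:
  assumes "C \<in> colors D"
  shows "unary (mult C D) \<subseteq> {..<3 * L}"
proof
  fix q assume "q \<in> unary (mult C D)"
  then have "0 < mult C D (q div 3)" by (auto simp: unary_def)
  then obtain v where "v \<in> D" "vtype v * k + C v = q div 3"
    unfolding mult_def by (metis (mono_tags, lifting) card.empty empty_Collect_eq less_irrefl)
  with key_less[OF vtype_less, of "C v" v] assms have "q div 3 < L" by (auto simp: colors_def)
  then show "q \<in> {..<3 * L}" by auto
qed

lemma finite_unary: "C \<in> colors D \<Longrightarrow> finite (unary (mult C D))"
  using unary_sub finite_subset by blast

lemma colors_mono: "B \<subseteq> D \<Longrightarrow> C \<in> colors D \<Longrightarrow> C \<in> colors B"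
  by (auto simp: colors_def)

lemma decode_state:
  assumes "C \<in> colors D" "B \<subseteq> D"
  shows "set_decode (state C D B) = unary (mult C D) \<union> (+) (3 * L) ` unary (mult C B)"
  using finite_unary assms colors_mono by (simp add: state_def)

lemma mult_insert:
  "finite A \<Longrightarrow> v \<notin> A \<Longrightarrow> mult C (insert v A) =
    (mult C A)(vtype v * k + C v := Suc (mult C A (vtype v * k + C v)))"
proof (intro ext)
  fix p assume *: "finite A" "v \<notin> A"
  have "{u \<in> insert v A. vtype u * k + C u = p} =
    (if vtype v * k + C v = p then insert v {u \<in> A. vtype u * k + C u = p} else {u \<in> A. vtype u * k + C u = p})"
    by auto
  with * show "mult C (insert v A) p =
    ((mult C A)(vtype v * k + C v := Suc (mult C A (vtype v * k + C v)))) p"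
    by (simp add: mult_def)
qed

lemma mult_cong: "(\<And>v. v \<in> A \<Longrightarrow> C v = C' v) \<Longrightarrow> mult C A = mult C' A"
  unfolding mult_def by (intro ext arg_cong[of _ _ card]) auto

lemma state_cong: "(\<And>v. v \<in> D \<Longrightarrow> C v = C' v) \<Longrightarrow> B \<subseteq> D \<Longrightarrow> state C D B = state C' D B"
  unfolding state_def using mult_cong[of D C C'] mult_cong[of B C C'] by (simp add: subset_iff)

text \<open>The key of \<open>v\<close> gains one in both halves; as it is below \<open>L\<close>,
  its three positions in the lower half do not spill into the upper one.\<close>

lemma state_insert:
  assumes "finite D" "B \<subseteq> D" "v \<notin> D" "C \<in> colors (insert v D)"
  shows "state C (insert v D) (insert v B) =
    bump (3 * L + 3 * (vtype v * k + C v)) (bump (3 * (vtype v * k + C v)) (state C D B))"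
proof -
  let ?p = "vtype v * k + C v"
  have C: "C \<in> colors D" using assms colors_mono by blast
  have p: "?p < L" using key_less[OF vtype_less] assms by (auto simp: colors_def)
  have fin: "finite (unary (mult C D))" "finite (unary (mult C B))"
    using finite_unary[OF C] finite_unary[OF colors_mono[OF assms(2) C]] by auto
  have *: "unary (mult C (insert v A)) = raise (3 * ?p) (unary (mult C A))" if "finite A" "v \<notin> A" for A
    unfolding mult_insert[OF that] by (rule unary_raise)
  have D': "unary (mult C (insert v D)) = raise (3 * ?p) (unary (mult C D))"
    by (rule *) (use assms in auto)
  have B': "unary (mult C (insert v B)) = raise (3 * ?p) (unary (mult C B))"
    by (rule *) (use assms finite_subset[of B D] in auto)
  have "bump (3 * ?p) (state C D B) = set_encode (raise (3 * ?p) (unary (mult C D)) \<union> (+) (3 * L) ` unary (mult C B))"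
    unfolding bump_def decode_state[OF C assms(2)]
    by (subst raise_append[OF unary_sub[OF C]]) (use p in auto)
  then show ?thesis
    unfolding bump_def[of "3 * L + _"]
    using raise_append_shift[OF unary_sub[OF assms(4), unfolded D'], of "3 * ?p" "unary (mult C B)"] fin
    by (simp add: state_def D' B')
qed

lemma uniq_cong: "(\<And>u. u \<in> nb w \<Longrightarrow> C u = C' u) \<Longrightarrow> uniq C w = uniq C' w"
proof -
  assume "\<And>u. u \<in> nb w \<Longrightarrow> C u = C' u"
  then have "{u \<in> nb w. C u = c} = {u \<in> nb w. C' u = c}" for c by auto
  then show ?thesis by (simp add: uniq_def)
qed

text \<open>Coloring \<open>v\<close> cannot spoil the conditions on \<open>F\<close>, because the
  neighborhoods concerned lie in \<open>D\<close> and \<open>v\<close> does not.\<close>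

lemma vstep_reach:
  assumes "finite D" "B \<subseteq> D" "v \<notin> D" "\<And>w. w \<in> F \<Longrightarrow> nb w \<subseteq> D"
  shows "vstep (vtype v) (reach D B F) = reach (insert v D) (insert v B) F"
proof (intro equalityI subsetI)
  fix x assume "x \<in> vstep (vtype v) (reach D B F)"
  then obtain C c where C: "C \<in> colors D" "\<forall>w\<in>F. uniq C w" "c < k"
    and x: "x = bump (3 * L + 3 * (vtype v * k + c)) (bump (3 * (vtype v * k + c)) (state C D B))"
    by (auto simp: vstep_def reach_def)
  define C' where "C' = C(v := c)"
  have C': "C' \<in> colors (insert v D)" using C by (auto simp: C'_def colors_def)
  have agree: "C u = C' u" if "u \<in> D" for u using that assms by (auto simp: C'_def)
  have "uniq C' w" if "w \<in> F" for w
    using uniq_cong[of w C C'] agree assms(4)[OF that] that C(2) by blast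
  moreover have "x = state C' (insert v D) (insert v B)"
    unfolding x state_insert[OF assms(1-3) C'] state_cong[of D C C', OF agree assms(2), simplified]
    by (simp add: C'_def)
  ultimately show "x \<in> reach (insert v D) (insert v B) F" using C' by (auto simp: reach_def)
next
  fix x assume "x \<in> reach (insert v D) (insert v B) F"
  then obtain C where C: "C \<in> colors (insert v D)" "\<forall>w\<in>F. uniq C w" "x = state C (insert v D) (insert v B)"
    by (auto simp: reach_def)
  then have "state C D B \<in> reach D B F" "C v < k"
    using colors_mono[of D "insert v D"] by (auto simp: reach_def colors_def)
  then show "x \<in> vstep (vtype v) (reach D B F)"
    unfolding C(3) state_insert[OF assms(1-3) C(1)] vstep_def by blast
qed

lemma vsteps_reach:
  assumes "D \<subseteq> {..<n}" "\<And>v. v < n \<Longrightarrow> blk v \<Longrightarrow> v \<notin> D" "\<And>w. w \<in> F \<Longrightarrow> nb w \<subseteq> D"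
  shows "m \<le> n \<Longrightarrow> rec_nat (reach D {} F) (\<lambda>v S. if blk v then vstep (vtype v) S else S) m =
    reach (D \<union> {v. v < m \<and> blk v}) {v. v < m \<and> blk v} F"
proof (induction m)
  case (Suc m)
  let ?B = "{v. v < m \<and> blk v}"
  have fin: "finite (D \<union> ?B)" using assms(1) finite_subset by auto
  show ?case
  proof (cases "blk m")
    case True
    have "{v. v < Suc m \<and> blk v} = insert m ?B" using True by (auto simp: less_Suc_eq)
    moreover have "vstep (vtype m) (reach (D \<union> ?B) ?B F) = reach (insert m (D \<union> ?B)) (insert m ?B) F"
      by (rule vstep_reach) (use fin assms True Suc.prems in auto)
    ultimately show ?thesis using Suc True by simp
  next
    case False
    then have "{v. v < Suc m \<and> blk v} = ?B" by (auto simp: less_Suc_eq)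
    with Suc False show ?thesis by simp
  qed
qed simp

section \<open>Counts recovered from a state\<close>

lemma cnt_state:
  assumes "C \<in> colors D" "B \<subseteq> D" "\<sigma> < 2 ^ (2 * d)" "c < k"
  shows "cnt (state C D B) 0 \<sigma> c = min 3 (card {v \<in> D. vtype v = \<sigma> \<and> C v = c})"
    and "cnt (state C D B) (3 * L) \<sigma> c = min 3 (card {v \<in> B. vtype v = \<sigma> \<and> C v = c})"
proof -
  let ?p = "\<sigma> * k + c"
  have p: "?p < L" using assms key_less by simp
  have m: "mult C A ?p = card {v \<in> A. vtype v = \<sigma> \<and> C v = c}" if "A \<subseteq> D" for A
  proof -
    \<comment> \<open>Since \<open>C v < k\<close>, division by \<open>k\<close> recovers type and
      color from the key.\<close>
    have "vtype v * k + C v = ?p \<longleftrightarrow> vtype v = \<sigma> \<and> C v = c" if "v \<in> A" for v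
    proof
      assume eq: "vtype v * k + C v = ?p"
      have "C v < k" using that \<open>A \<subseteq> D\<close> assms(1) by (auto simp: colors_def)
      then have "(vtype v * k + C v) div k = vtype v" "(vtype v * k + C v) mod k = C v"
        "?p div k = \<sigma>" "?p mod k = c" using assms(4) by simp_all
      with eq show "vtype v = \<sigma> \<and> C v = c" by simp
    qed simp
    then show ?thesis unfolding mult_def by (intro arg_cong[of _ _ card]) auto
  qed
  have "0 + (3 * ?p + i) \<in> set_decode (state C D B) \<longleftrightarrow> 3 * ?p + i \<in> unary (mult C D)" if "i < 3" for i
    using p that unfolding decode_state[OF assms(1,2)] by auto
  then have "cnt (state C D B) 0 \<sigma> c = (\<Sum>i<3. if 3 * ?p + i \<in> unary (mult C D) then 1 else 0)"
    unfolding cnt_def by (intro sum.cong) auto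
  then show "cnt (state C D B) 0 \<sigma> c = min 3 (card {v \<in> D. vtype v = \<sigma> \<and> C v = c})"
    unfolding count_unary using m by simp
  have "3 * L + (3 * ?p + i) \<in> set_decode (state C D B) \<longleftrightarrow> 3 * ?p + i \<in> unary (mult C B)" for i
    using unary_sub[OF assms(1)] unfolding decode_state[OF assms(1,2)] by auto
  then have "cnt (state C D B) (3 * L) \<sigma> c = (\<Sum>i<3. if 3 * ?p + i \<in> unary (mult C B) then 1 else 0)"
    unfolding cnt_def by (intro sum.cong) auto
  then show "cnt (state C D B) (3 * L) \<sigma> c = min 3 (card {v \<in> B. vtype v = \<sigma> \<and> C v = c})"
    unfolding count_unary using m assms(2) by simp
qed

text \<open>Capping per type and counting without a cap agree only after a final cap, hence
  \<open>min 3\<close> on both sides.\<close>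

lemma seen_state:
  assumes "C \<in> colors D" "B \<subseteq> D" "c < k" "finite D"
  shows "min 3 (seen (state C D B) r c) = min 3 (card {v \<in> D. r \<in> set_decode (vtype v) \<and> C v = c})"
proof -
  let ?T = "{\<sigma>. \<sigma> < 2 ^ (2 * d) \<and> r \<in> set_decode \<sigma>}"
  have "seen (state C D B) r c = (\<Sum>\<sigma>\<in>?T. cnt (state C D B) 0 \<sigma> c)"
    unfolding seen_def by (intro sum.mono_neutral_cong_right) auto
  also have "\<dots> = (\<Sum>\<sigma>\<in>?T. min 3 (card {v \<in> D. vtype v = \<sigma> \<and> C v = c}))"
    by (intro sum.cong refl cnt_state) (use assms in auto)
  finally have "min 3 (seen (state C D B) r c) = min 3 (\<Sum>\<sigma>\<in>?T. card {v \<in> D. vtype v = \<sigma> \<and> C v = c})"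
    by (simp add: min_sum_min)
  also have "(\<Sum>\<sigma>\<in>?T. card {v \<in> D. vtype v = \<sigma> \<and> C v = c}) = card {v \<in> D. vtype v \<in> ?T \<and> C v = c}"
    by (rule sum_card_fibers) (use assms in auto)
  also have "{v \<in> D. vtype v \<in> ?T \<and> C v = c} = {v \<in> D. r \<in> set_decode (vtype v) \<and> C v = c}"
    using vtype_less by auto
  finally show ?thesis .
qed

lemma in_clique_state:
  assumes "C \<in> colors D" "B \<subseteq> D" "c < k" "finite D"
  shows "min 3 (in_clique (state C D B) c) = min 3 (card {v \<in> B - X. C v = c})"
proof -
  have "in_clique (state C D B) c = (\<Sum>\<sigma><2 ^ d. min 3 (card {v \<in> B. vtype v = \<sigma> \<and> C v = c}))"
    unfolding in_clique_def by (intro sum.cong refl cnt_state) (use assms less_power_double in auto)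
  then have "min 3 (in_clique (state C D B) c) = min 3 (\<Sum>\<sigma><2 ^ d. card {v \<in> B. vtype v = \<sigma> \<and> C v = c})"
    by (simp add: min_sum_min)
  also have "(\<Sum>\<sigma><2 ^ d. card {v \<in> B. vtype v = \<sigma> \<and> C v = c}) = card {v \<in> B. vtype v \<in> {..<2 ^ d} \<and> C v = c}"
    by (rule sum_card_fibers) (use assms finite_subset in auto)
  also have "{v \<in> B. vtype v \<in> {..<2 ^ d} \<and> C v = c} = {v \<in> B - X. C v = c}"
    using vtype_less_iff by auto
  finally show ?thesis .
qed

text \<open>Only \<open>x\<close> carries the identity bit of \<open>x\<close>, so the cap is never
  reached and the equation is exact.\<close>

lemma identity_seen_state:
  assumes "C \<in> colors D" "B \<subseteq> D" "c < k" "finite D" "X \<subseteq> D" "x \<in> X"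
  shows "seen (state C D B) (d + rank x) c = (if C x = c then 1 else 0)"
proof -
  have "{v \<in> D. d + rank x \<in> set_decode (vtype v) \<and> C v = c} = (if C x = c then {x} else {})"
    using assms by (auto simp: identity_in_vtype)
  then show ?thesis using seen_state[OF assms(1-4), of "d + rank x"]
    by (auto simp: min_def split: if_splits)
qed

text \<open>Exact, being a sum of the values 0 and 1 from \<open>identity_seen_state\<close>,
  indexed by \<open>X\<close> through \<open>rank\<close>.\<close>

lemma modulator_neighbors_seen:
  assumes "C \<in> colors D" "B \<subseteq> D" "c < k" "finite D" "X \<subseteq> D"
  shows "(\<Sum>r<d. if r \<in> set_decode (vtype v) then seen (state C D B) (d + r) c else 0) =
    card {x \<in> X \<inter> nb v. C x = c}"
proof -
  have "(\<Sum>r<d. if r \<in> set_decode (vtype v) then seen (state C D B) (d + r) c else 0) =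
    (\<Sum>x\<in>X. if rank x \<in> set_decode (vtype v) then seen (state C D B) (d + rank x) c else 0)"
    by (rule sum.reindex_bij_betw[OF bij_rank, symmetric])
  also have "\<dots> = (\<Sum>x\<in>X. if x \<in> nb v \<and> C x = c then 1 else 0)"
    by (intro sum.cong refl) (use assms in \<open>auto simp: neighbor_in_vtype identity_seen_state\<close>)
  also have "\<dots> = card {x \<in> X. x \<in> nb v \<and> C x = c}" by (simp add: sum.If_cases Int_def)
  also have "{x \<in> X. x \<in> nb v \<and> C x = c} = {x \<in> X \<inter> nb v. C x = c}" by auto
  finally show ?thesis .
qed

lemma uniq_iff_less:
  assumes "C \<in> colors D" "nb v \<subseteq> D"
  shows "uniq C v \<longleftrightarrow> (\<exists>c<k. card {u \<in> nb v. C u = c} = 1)"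
proof
  assume "uniq C v"
  then obtain c where c: "card {u \<in> nb v. C u = c} = 1" by (auto simp: uniq_def)
  then obtain u where "{u \<in> nb v. C u = c} = {u}" by (meson card_1_singletonE)
  then have "u \<in> nb v" "C u = c" by auto
  with assms c show "\<exists>c<k. card {u \<in> nb v. C u = c} = 1" by (auto simp: colors_def)
qed (auto simp: uniq_def)

lemma seen_in_clique:
  assumes "C \<in> colors D" "B \<subseteq> D" "\<tau> < 2 ^ d" "c < k" "finite D"
  shows "3 * L + 3 * (\<tau> * k + c) \<in> set_decode (state C D B) \<longleftrightarrow> (\<exists>v\<in>B. vtype v = \<tau> \<and> C v = c)"
proof -
  have \<tau>: "\<tau> < 2 ^ (2 * d)" using assms less_power_double by blast
  have mem: "3 * L + (3 * (\<tau> * k + c) + i) \<in> set_decode (state C D B) \<longleftrightarrow> i < mult C B (\<tau> * k + c)" if "i < 3" for i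
  proof -
    have "3 * L + (3 * (\<tau> * k + c) + i) \<in> set_decode (state C D B) \<longleftrightarrow> 3 * (\<tau> * k + c) + i \<in> unary (mult C B)"
      using unary_sub[OF assms(1)] unfolding decode_state[OF assms(1,2)] by auto
    also have "\<dots> \<longleftrightarrow> i < mult C B (\<tau> * k + c)" by (rule mem_unary[OF that])
    finally show ?thesis .
  qed
  have "mult C B (\<tau> * k + c) = 0 \<longleftrightarrow> cnt (state C D B) (3 * L) \<tau> c = 0"
    unfolding cnt_def using mem by (auto split: if_splits)
  also have "\<dots> \<longleftrightarrow> card {v \<in> B. vtype v = \<tau> \<and> C v = c} = 0"
    unfolding cnt_state(2)[OF assms(1,2) \<tau> assms(4)] by (auto simp: min_def)
  also have "\<dots> \<longleftrightarrow> \<not> (\<exists>v\<in>B. vtype v = \<tau> \<and> C v = c)"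
    using finite_subset[OF assms(2,5)] by (auto simp: card_eq_0_iff)
  finally show ?thesis using mem[of 0] by auto
qed

lemma eq_of_min_eq: "min 3 a = min 3 b \<Longrightarrow> m < 3 \<Longrightarrow> a = m \<longleftrightarrow> b = (m::nat)"
  by (auto simp: min_def split: if_splits)

text \<open>The test speaks of keys, not of vertices. This suffices because members of a clique with
  the same type and color have the same neighbors in \<open>X\<close> and, apart from themselves,
  the same neighbors in the clique. The first alternative of \<open>block\<close> covers the
  modulator phase and empty blocks, where the test is void; the second describes a complete
  clique.\<close>

lemma clique_ok_state:
  assumes C: "C \<in> colors D" and "B \<subseteq> D" "finite D" "D \<subseteq> {..<n}"
    and block: "B \<subseteq> X \<or> X \<subseteq> D \<and> B \<inter> X = {} \<and> (\<forall>v\<in>B. nb v - X = (if cn then B else B - {v}))"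
  shows "clique_ok (state C D B) \<longleftrightarrow> (\<forall>v\<in>B - X. uniq C v)"
proof (cases "B \<subseteq> X")
  case True
  then have "\<not> (\<exists>v\<in>B. vtype v = \<tau> \<and> C v = c)" if "\<tau> < 2 ^ d" for \<tau> c
    using vtype_less_iff that by auto
  then show ?thesis using seen_in_clique[OF assms(1,2) _ _ assms(3)] True by (auto simp: clique_ok_def)
next
  case False
  with block have XD: "X \<subseteq> D" and BX: "B \<inter> X = {}" and
    nbB: "\<And>v. v \<in> B \<Longrightarrow> nb v - X = (if cn then B else B - {v})" by auto
  have finB: "finite B" using assms finite_subset by blast
  have eq: "(in_clique (state C D B) c + (\<Sum>r<d. if r \<in> set_decode (vtype v) then seen (state C D B) (d + r) c else 0) =
        1 + (if cn \<or> c \<noteq> C v then 0 else 1)) \<longleftrightarrow> card {u \<in> nb v. C u = c} = 1"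
    if v: "v \<in> B" and c: "c < k" for v c
  proof -
    have "v < n" using v assms by auto
    let ?a = "card {x \<in> X \<inter> nb v. C x = c}" and ?b = "card {u \<in> B. C u = c}"
    have "{u \<in> nb v. C u = c} = {x \<in> X \<inter> nb v. C x = c} \<union> {u \<in> nb v - X. C u = c}" by auto
    moreover have "card ({x \<in> X \<inter> nb v. C x = c} \<union> {u \<in> nb v - X. C u = c}) =
      ?a + card {u \<in> nb v - X. C u = c}"
      using finite_nb[OF \<open>v < n\<close>] by (intro card_Un_disjoint) auto
    ultimately have 1: "card {u \<in> nb v. C u = c} = ?a + card {u \<in> nb v - X. C u = c}" by simp
    have 2: "?b = card {u \<in> nb v - X. C u = c} + (if cn \<or> c \<noteq> C v then 0 else 1)"
    proof (cases "cn \<or> c \<noteq> C v")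
      case True
      then have "{u \<in> nb v - X. C u = c} = {u \<in> B. C u = c}" using nbB[OF v] by auto
      with True show ?thesis by simp
    next
      case False
      then have "{u \<in> B. C u = c} = insert v {u \<in> nb v - X. C u = c}" "v \<notin> {u \<in> nb v - X. C u = c}"
        using nbB[OF v] v by auto
      with False show ?thesis using finite_nb[OF \<open>v < n\<close>] by simp
    qed
    have "B - X = B" using BX by auto
    then have "min 3 (in_clique (state C D B) c) = min 3 ?b"
      using in_clique_state[OF assms(1,2) c assms(3)] by simp
    then have "min 3 (in_clique (state C D B) c + ?a) = min 3 (?b + ?a)"
      by (auto simp: min_def split: if_splits)
    then have "in_clique (state C D B) c + ?a = 1 + (if cn \<or> c \<noteq> C v then 0 else 1) \<longleftrightarrow>
      ?b + ?a = 1 + (if cn \<or> c \<noteq> C v then 0 else 1)"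
      by (rule eq_of_min_eq) auto
    then show ?thesis unfolding modulator_neighbors_seen[OF assms(1,2) c assms(3) XD] using 1 2 by auto
  qed
  have nbD: "nb v \<subseteq> D" if "v \<in> B" for v
    using nbB[OF that] XD \<open>B \<subseteq> D\<close> by (auto split: if_splits)
  define Q where "Q \<tau> c' \<longleftrightarrow> (\<exists>c<k. in_clique (state C D B) c +
    (\<Sum>r<d. if r \<in> set_decode \<tau> then seen (state C D B) (d + r) c else 0) =
        1 + (if cn \<or> c \<noteq> c' then 0 else 1))" for \<tau> c'
  have "clique_ok (state C D B) \<longleftrightarrow>
      (\<forall>\<tau><2 ^ d. \<forall>c<k. (\<exists>v\<in>B. vtype v = \<tau> \<and> C v = c) \<longrightarrow> Q \<tau> c)"
    unfolding clique_ok_def Q_def[symmetric]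
    by (simp only: seen_in_clique[OF assms(1,2) _ _ assms(3)] cong: imp_cong)
  also have "\<dots> \<longleftrightarrow> (\<forall>v\<in>B. Q (vtype v) (C v))"
  proof -
    have "vtype v < 2 ^ d" "C v < k" if "v \<in> B" for v
      using that BX C \<open>B \<subseteq> D\<close> by (auto simp: vtype_less_iff colors_def)
    then show ?thesis by blast
  qed
  also have "\<dots> \<longleftrightarrow> (\<forall>v\<in>B. uniq C v)" 
    unfolding Q_def using eq uniq_iff_less[OF C nbD] by blast
  also have "\<dots> \<longleftrightarrow> (\<forall>v\<in>B - X. uniq C v)" using BX by auto
  finally show ?thesis .
qed

lemma state_reset:
  assumes "C \<in> colors D" "B \<subseteq> D"
  shows "set_encode (set_decode (state C D B) \<inter> {..<3 * L}) = state C D {}"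
proof -
  have "set_decode (state C D B) \<inter> {..<3 * L} = unary (mult C D)"
    using unary_sub[OF assms(1)] unfolding decode_state[OF assms] by auto
  moreover have "unary (mult C {}) = {}" by (auto simp: unary_def mult_def)
  ultimately show ?thesis by (simp add: state_def)
qed

lemma estep_reach:
  assumes "B \<subseteq> D" "finite D" "D \<subseteq> {..<n}"
    and "B \<subseteq> X \<or> X \<subseteq> D \<and> B \<inter> X = {} \<and> (\<forall>v\<in>B. nb v - X = (if cn then B else B - {v}))"
  shows "estep (reach D B F) = reach D {} (F \<union> (B - X))"
proof -
  have "estep (reach D B F) = {state C D {} | C. C \<in> colors D \<and> (\<forall>w\<in>F. uniq C w) \<and> (\<forall>v\<in>B - X. uniq C v)}"
    unfolding estep_def reach_def using clique_ok_state[OF _ assms] state_reset[OF _ assms(1)]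
    by (auto, metis+)
  then show ?thesis by (auto simp: reach_def)
qed

section \<open>The two phases and the final test\<close>

lemma phase_step:
  assumes "D \<subseteq> {..<n}" "\<And>v. v < n \<Longrightarrow> blk v \<Longrightarrow> v \<notin> D" "\<And>w. w \<in> F \<Longrightarrow> nb w \<subseteq> D"
    and "B = {v. v < n \<and> blk v}"
    and "B \<subseteq> X \<or> X \<subseteq> D \<and> B \<inter> X = {} \<and> (\<forall>v\<in>B. nb v - X = (if cn then B else B - {v}))"
  shows "estep (rec_nat (reach D {} F) (\<lambda>v S. if blk v then vstep (vtype v) S else S) n) =
    reach (D \<union> B) {} (F \<union> (B - X))"
proof -
  have "rec_nat (reach D {} F) (\<lambda>v S. if blk v then vstep (vtype v) S else S) n = reach (D \<union> B) B F"
    using vsteps_reach[OF assms(1-3), where m = n] by (simp add: assms(4))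
  moreover have "estep (reach (D \<union> B) B F) = reach (D \<union> B) {} (F \<union> (B - X))"
  proof (rule estep_reach)
    show "D \<union> B \<subseteq> {..<n}" using assms(1,4) by blast
    then show "finite (D \<union> B)" using finite_subset by blast
  qed (use assms(5) in blast)+
  ultimately show ?thesis by simp
qed

text \<open>Nothing is demanded of the colorings yet: all blocks are contained in \<open>X\<close>,
  whose elements are tested only when all their neighbors are colored.\<close>

lemma modulator_phase: "phase modulator_block (reach {} {} {}) = reach X {} {}"
proof -
  have "rec_nat (reach {} {} {}) (\<lambda>u S. estep
     (rec_nat S (\<lambda>v S. if modulator_block u v then vstep (vtype v) S else S) n)) m =
     reach {x \<in> X. x < m} {} {}" if "m \<le> n" for m
    using that
  proof (induction m)
    case (Suc m)
    let ?B = "{v. v < n \<and> modulator_block m v}"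
    have B: "?B \<subseteq> X" "{x \<in> X. x < m} \<union> ?B = {x \<in> X. x < Suc m}"
      using X_sub by (auto simp: modulator_block_def less_Suc_eq)
    have "estep (rec_nat (reach {x \<in> X. x < m} {} {}) (\<lambda>v S. if modulator_block m v then vstep (vtype v) S else S) n) =
      reach ({x \<in> X. x < m} \<union> ?B) {} ({} \<union> (?B - X))"
      by (rule phase_step) (use X_sub B(1) in \<open>auto simp: modulator_block_def\<close>)
    also have "\<dots> = reach {x \<in> X. x < Suc m} {} {}"
      using B by (simp only: B(2)) (simp add: Diff_eq_empty_iff[THEN iffD2])
    finally show ?case using Suc by simp
  qed simp
  moreover have "{x \<in> X. x < n} = X" using X_sub by auto
  ultimately show ?thesis by (simp add: phase_def)
qed

text \<open>For \<open>v\<close> outside \<open>X\<close>, the least vertex of its clique; it serves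
  as the name of the clique.\<close>

definition lead :: "nat \<Rightarrow> nat" where
  "lead v = (LEAST u. u \<notin> X \<and> (u = v \<or> (u, v) \<in> E))"

lemma lead:
  assumes "v \<notin> X"
  shows "lead v \<notin> X \<and> (lead v = v \<or> (lead v, v) \<in> E)" "lead v \<le> v"
  unfolding lead_def using assms
    LeastI[of "\<lambda>u. u \<notin> X \<and> (u = v \<or> (u, v) \<in> E)" v] Least_le[of "\<lambda>u. u \<notin> X \<and> (u = v \<or> (u, v) \<in> E)" v]
  by auto

text \<open>By symmetry and transitivity both vertices have the same closed neighborhood outside
  \<open>X\<close>, so the two minima are taken over the same set.\<close>

lemma lead_eq:
  assumes "(u, v) \<in> E" "u \<notin> X" "v \<notin> X"
  shows "lead u = lead v"
proof -
  have "(w \<notin> X \<and> (w = u \<or> (w, u) \<in> E)) = (w \<notin> X \<and> (w = v \<or> (w, v) \<in> E))" for w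
    using assms E_sym E_trans by metis
  then show ?thesis by (simp add: lead_def)
qed

lemma clique_phase: "phase clique_block (reach X {} {}) = reach {..<n} {} ({..<n} - X)"
proof -
  have block: "clique_block u v \<longleftrightarrow> v \<notin> X \<and> lead v = u" for u v
  proof
    assume "clique_block u v"
    then show "v \<notin> X \<and> lead v = u" unfolding clique_block_def lead_def
      by (auto intro!: Least_equality) (metis leI)+
  next
    assume a: "v \<notin> X \<and> lead v = u"
    have "w \<in> X \<or> w \<noteq> v \<and> (w, v) \<notin> E" if "w < u" for w
      using not_less_Least[of w "\<lambda>u. u \<notin> X \<and> (u = v \<or> (u, v) \<in> E)"] that a by (auto simp: lead_def)
    with a lead[of v] show "clique_block u v" by (auto simp: clique_block_def)
  qed
  have clique: "(u, v) \<in> E" if "lead u = lead v" "u \<notin> X" "v \<notin> X" "u \<noteq> v" for u v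
    using lead[of u] lead[of v] that E_sym E_trans by metis
  have nbv: "nb v - X = (let K = {u. u < n \<and> u \<notin> X \<and> lead u = lead v} in if cn then K else K - {v})"
    if v: "v \<notin> X" "v < n" for v
  proof -
    have "(v, u) \<in> E \<longleftrightarrow> u < n \<and> lead u = lead v" if "u \<notin> X" "u \<noteq> v" for u
      using lead_eq[of v u] clique[of v u] v that E_sub by auto
    then have *: "u \<in> nb v - X \<longleftrightarrow> u < n \<and> u \<notin> X \<and> lead u = lead v \<and> (cn \<or> u \<noteq> v)" for u
      using v E_irrefl[of v] by (cases "u = v") (auto simp: nb_def)
    show ?thesis by (rule set_eqI, subst *) (simp add: Let_def)
  qed
  have nb_lead: "u < n \<and> lead u = lead v" if "v \<notin> X" "v < n" "u \<in> nb v" "u \<notin> X" for u v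
  proof -
    have "u \<in> nb v - X" using that by simp
    then show ?thesis unfolding nbv[OF that(1,2)] Let_def by (simp split: if_splits)
  qed
  \<comment> \<open>The set processed after \<open>m\<close> rounds. Apart from \<open>X\<close> it
    consists of whole cliques, so the neighborhoods of the vertices tested so far lie inside
    it.\<close>
  define D where "D m = X \<union> {v. v < n \<and> v \<notin> X \<and> lead v < m}" for m
  have "rec_nat (reach X {} {}) (\<lambda>u S. estep
     (rec_nat S (\<lambda>v S. if clique_block u v then vstep (vtype v) S else S) n)) m =
     reach (D m) {} (D m - X)" if "m \<le> n" for m
    using that
  proof (induction m)
    case 0
    then show ?case by (simp add: D_def)
  next
    case (Suc m)
    let ?B = "{v. v < n \<and> v \<notin> X \<and> lead v = m}"
    have D: "D m \<union> ?B = D (Suc m)" "D m - X \<union> (?B - X) = D (Suc m) - X" by (auto simp: D_def less_Suc_eq)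
    have "estep (rec_nat (reach (D m) {} (D m - X)) (\<lambda>v S. if clique_block m v then vstep (vtype v) S else S) n) =
      reach (D m \<union> ?B) {} ((D m - X) \<union> (?B - X))"
    proof (rule phase_step)
      show "D m \<subseteq> {..<n}" using X_sub by (auto simp: D_def)
      show "?B = {v. v < n \<and> clique_block m v}" by (auto simp: block)
      show "?B \<subseteq> X \<or> X \<subseteq> D m \<and> ?B \<inter> X = {} \<and> (\<forall>v\<in>?B. nb v - X = (if cn then ?B else ?B - {v}))"
        using nbv by (fastforce simp: D_def Let_def)
      show "v \<notin> D m" if "clique_block m v" for v using that by (auto simp: D_def block)
      show "nb w \<subseteq> D m" if "w \<in> D m - X" for w
        using nb_lead[of w] that by (auto simp: D_def)
    qed
    with D Suc show ?case by simp
  qed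
  moreover have "D n = {..<n}" using X_sub lead by (auto simp: D_def intro: le_less_trans)
  ultimately show ?thesis by (simp add: phase_def)
qed

text \<open>By the symmetry of \<open>nb\<close>, the vertices whose type contains the adjacency bit
  of \<open>x\<close> are exactly the elements of \<open>nb x\<close>.\<close>

lemma modulator_ok_state:
  assumes "C \<in> colors {..<n}"
  shows "modulator_ok (state C {..<n} {}) \<longleftrightarrow> (\<forall>x\<in>X. uniq C x)"
proof -
  have "seen (state C {..<n} {}) (rank x) c = 1 \<longleftrightarrow> card {u \<in> nb x. C u = c} = 1" if "x \<in> X" "c < k" for x c
  proof -
    have "{v \<in> {..<n}. rank x \<in> set_decode (vtype v) \<and> C v = c} = {u \<in> nb x. C u = c}"
      using nb_sub[of x] X_sub that by (auto simp: neighbor_in_vtype nb_sym[of x])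
    with seen_state[OF assms _ that(2), of "{}" "rank x"] show ?thesis by (intro eq_of_min_eq) auto
  qed
  then have "(\<exists>c<k. seen (state C {..<n} {}) (rank x) c = 1) \<longleftrightarrow>
      (\<exists>c<k. card {u \<in> nb x. C u = c} = 1)" if "x \<in> X" for x
    using that by blast
  moreover have "(\<forall>r<d. P r) \<longleftrightarrow> (\<forall>x\<in>X. P (rank x))" for P
    using bij_rank unfolding bij_betw_def by (metis imageE imageI lessThan_iff)
  ultimately have "modulator_ok (state C {..<n} {}) \<longleftrightarrow> (\<forall>x\<in>X. \<exists>c<k. card {u \<in> nb x. C u = c} = 1)"
    unfolding modulator_ok_def by simp
  also have "\<dots> \<longleftrightarrow> (\<forall>x\<in>X. uniq C x)" 
  proof (intro ball_cong refl)
    fix x assume "x \<in> X"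
    then have "x < n" using X_sub by auto
    then show "(\<exists>c<k. card {u \<in> nb x. C u = c} = 1) \<longleftrightarrow> uniq C x"
      using uniq_iff_less[OF assms nb_sub] by simp
  qed
  finally show ?thesis .
qed

theorem accepted_iff: "accepted \<longleftrightarrow> (\<exists>C\<in>{..<n} \<rightarrow> {..<k}. \<forall>v<n. uniq C v)"
proof -
  \<comment> \<open>With all counters empty the code is 0, so \<open>{0}\<close> is the correct
    start.\<close>
  have "state C {} {} = 0" for C
    by (simp add: state_def mult_def unary_def)
  then have "reach {} {} {} = {0}" by (auto simp: reach_def colors_def)
  then have "accepted \<longleftrightarrow> (\<exists>j\<in>reach {..<n} {} ({..<n} - X). modulator_ok j)"
    using modulator_phase clique_phase by (simp add: accepted_def)
  also have "\<dots> \<longleftrightarrow> (\<exists>C\<in>colors {..<n}. (\<forall>v\<in>{..<n} - X. uniq C v) \<and> (\<forall>x\<in>X. uniq C x))"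
    by (auto simp: reach_def modulator_ok_state)
  also have "\<dots> \<longleftrightarrow> (\<exists>C\<in>colors {..<n}. \<forall>v<n. uniq C v)" using X_sub by blast
  finally show ?thesis by (simp add: colors_def)
qed

text \<open>The vertices of \<open>X\<close> and one neighbor of each get private colors. In each clique, at most two of
  the remaining vertices are marked by two further colors; every vertex without neighbors in \<open>X\<close>
  then sees a marked or privately colored vertex of its clique.\<close>

theorem many_colors:
  assumes k: "2 * d + 3 \<le> k" and nb: "\<And>v. v < n \<Longrightarrow> nb v \<noteq> {}"
  shows "\<exists>C\<in>{..<n} \<rightarrow> {..<k}. \<forall>v<n. uniq C v"
proof -
  have "\<forall>x\<in>X. \<exists>u. u \<in> nb x" using nb X_sub by blast
  then obtain w where w: "\<And>x. x \<in> X \<Longrightarrow> w x \<in> nb x" by metis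
  define Z where "Z = X \<union> w ` X"
  have "card Z \<le> 2 * d"
    unfolding Z_def d_def using card_Un_le[of X "w ` X"] card_image_le[of X w] by simp
  moreover obtain f m where f: "f ` Z = {i::nat. i < m}" "inj_on f Z"
    using finite_imp_inj_to_nat_seg[of Z] by (auto simp: Z_def)
  moreover have "m = card Z" using f card_image[of f Z] by simp
  ultimately have f_less: "f z < 2 * d" if "z \<in> Z" for z
    using that by (metis imageI mem_Collect_eq order_less_le_trans)
  \<comment> \<open>Used at clique leaders, where it is the second smallest vertex of the
    clique.\<close>
  define sec where "sec v = (LEAST u. u \<notin> X \<and> (u, v) \<in> E)" for v
  \<comment> \<open>The private colors \<open>f v\<close> lie below \<open>2 * d\<close>. The last
    color, shared by all remaining vertices, never serves as a unique color in this
    argument.\<close>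
  define C where "C v = (if v \<in> Z then f v else if v = lead v then 2 * d
    else if v = sec (lead v) then 2 * d + 1 else 2 * d + 2)" for v
  have uniqI: "uniq C v" if "v < n" "z \<in> nb v" "\<And>u. u \<in> nb v \<Longrightarrow> C u = C z \<Longrightarrow> u = z" for v z
  proof -
    have "{u \<in> nb v. C u = C z} = {z}" using that by auto
    then show ?thesis unfolding uniq_def by (metis card_1_singleton_iff One_nat_def)
  qed
  have C_Z: "u = z" if "z \<in> Z" "C u = C z" for u z
  proof -
    have "C u < 2 * d" using that f_less[of z] by (simp add: C_def)
    then have "u \<in> Z" by (auto simp: C_def split: if_splits)
    with that f(2) show ?thesis by (simp add: C_def inj_on_def)
  qed
  have C_lead: "u \<notin> Z \<and> u = lead u" if "C u = 2 * d" for u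
    using that f_less[of u] by (auto simp: C_def split: if_splits)
  have C_sec: "u \<notin> Z \<and> u = sec (lead u)" if "C u = 2 * d + 1" for u
    using that f_less[of u] by (auto simp: C_def split: if_splits)
  have "uniq C v" if v: "v < n" for v
  proof (cases "nb v \<inter> Z = {}")
    case False
    then obtain z where "z \<in> nb v" "z \<in> Z" by auto
    then show ?thesis using uniqI[OF v] C_Z by blast
  next
    case True
    \<comment> \<open>An element \<open>x\<close> of \<open>X\<close> sees \<open>w x\<close>, which
      has a private color.\<close>
    then have vX: "v \<notin> X" using w by (auto simp: Z_def)
    have nbX: "u \<notin> X" if "u \<in> nb v" for u using True that by (auto simp: Z_def)
    have lead_nb: "lead u = lead v" if "u \<in> nb v" for u
    proof (cases "u = v")
      case False
      then have "(v, u) \<in> E" using that by (auto simp: nb_def)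
      then show ?thesis using lead_eq nbX[OF that] vX by metis
    qed simp
    \<comment> \<open>The leader is visible unless \<open>v\<close> is the leader and neighborhoods
      are open; in that case the second vertex of the clique takes its role.\<close>
    show ?thesis
    proof (cases "lead v \<in> nb v")
      case l: True
      then have "C (lead v) = 2 * d" using lead_nb[OF l] True by (auto simp: C_def)
      show ?thesis
      proof (rule uniqI[OF v l])
        fix u assume u: "u \<in> nb v" "C u = C (lead v)"
        with \<open>C (lead v) = 2 * d\<close> C_lead[of u] have "u = lead u" by simp
        with lead_nb[OF u(1)] show "u = lead v" by simp
      qed
    next
      case l: False
      have "lead v = v" using lead(1)[OF vX] l E_sym by (auto simp: nb_def)
      with l have "\<not> cn" by (auto simp: nb_def)
      obtain u where u: "u \<in> nb v" using nb[OF v] by auto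
      then have "(v, u) \<in> E" using \<open>\<not> cn\<close> unfolding nb_def by simp
      then have "u \<notin> X \<and> (u, v) \<in> E" using nbX[OF u] E_sym by blast
      then have "sec v \<notin> X \<and> (sec v, v) \<in> E" unfolding sec_def by (rule LeastI)
      then have s: "sec v \<in> nb v" "sec v \<noteq> v" using E_sym E_irrefl by (auto simp: nb_def)
      then have Cs: "C (sec v) = 2 * d + 1"
        using lead_nb[OF s(1)] True \<open>lead v = v\<close> by (auto simp: C_def)
      show ?thesis
      proof (rule uniqI[OF v s(1)])
        fix u assume u: "u \<in> nb v" "C u = C (sec v)"
        with Cs C_sec[of u] have "u = sec (lead u)" by simp
        with lead_nb[OF u(1)] \<open>lead v = v\<close> show "u = sec v" by simp
      qed
    qed
  qed
  moreover have "C v < k" for v using f_less[of v] k by (auto simp: C_def)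
  ultimately show ?thesis by (intro bexI[of _ C]) auto
qed

end

section \<open>Derived terms\<close>

definition fresh :: "trm \<Rightarrow> nat" where
  "fresh t = Suc (Max (insert 0 (fv t)))"

lemma fresh_not_in_fv [simp]: "fresh t \<le> x \<Longrightarrow> x \<notin> fv t"
proof
  assume "fresh t \<le> x" "x \<in> fv t"
  then have "x \<le> Max (insert 0 (fv t))" by (intro Max_ge) auto
  with \<open>fresh t \<le> x\<close> show False unfolding fresh_def by linarith
qed

definition holds :: "input \<Rightarrow> trm \<Rightarrow> env \<Rightarrow> bool" where
  "holds A \<phi> e \<longleftrightarrow> ev A \<phi> e \<noteq> 0"

definition if_trm :: "trm \<Rightarrow> trm \<Rightarrow> trm \<Rightarrow> trm" where
  "if_trm \<phi> t u = IfLess (Num 0) \<phi> t u"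

definition less_trm :: "trm \<Rightarrow> trm \<Rightarrow> trm" where
  "less_trm s t = IfLess s t (Num 1) (Num 0)"

definition neg_trm :: "trm \<Rightarrow> trm" where
  "neg_trm \<phi> = if_trm \<phi> (Num 0) (Num 1)"

definition conj_trm :: "trm \<Rightarrow> trm \<Rightarrow> trm" where
  "conj_trm \<phi> \<psi> = if_trm \<phi> \<psi> (Num 0)"

definition disj_trm :: "trm \<Rightarrow> trm \<Rightarrow> trm" where
  "disj_trm \<phi> \<psi> = if_trm \<phi> (Num 1) \<psi>"

definition eq_trm :: "trm \<Rightarrow> trm \<Rightarrow> trm" where
  "eq_trm s t = neg_trm (disj_trm (less_trm s t) (less_trm t s))"

text \<open>A loop with one round: the accumulator starts as \<open>s\<close> and is replaced by
  \<open>t\<close> once. The counter avoids \<open>x\<close> and the variables of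
  \<open>t\<close>.\<close>

definition let_trm :: "nat \<Rightarrow> trm \<Rightarrow> trm \<Rightarrow> trm" where
  "let_trm x s t = Iterate x (max (fresh t) (Suc x)) (Num 1) s t"

definition sum_trm :: "nat \<Rightarrow> trm \<Rightarrow> trm \<Rightarrow> trm" where
  "sum_trm x b t = Iterate (max (fresh t) (Suc x)) x b (Num 0) (Plus (Ref (max (fresh t) (Suc x))) t)"

definition ex_trm :: "nat \<Rightarrow> trm \<Rightarrow> trm \<Rightarrow> trm" where
  "ex_trm x b \<phi> = sum_trm x b (if_trm \<phi> (Num 1) (Num 0))"

definition all_trm :: "nat \<Rightarrow> trm \<Rightarrow> trm \<Rightarrow> trm" where
  "all_trm x b \<phi> = neg_trm (ex_trm x b (neg_trm \<phi>))"

text \<open>Variables 0 and 1 capture nothing, because \<open>t\<close> is the loop length and is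
  evaluated outside the loop.\<close>

definition pow2_trm :: "trm \<Rightarrow> trm" where
  "pow2_trm t = Iterate 0 1 t (Num 1) (Plus (Ref 0) (Ref 0))"

definition times_trm :: "trm \<Rightarrow> trm \<Rightarrow> trm" where
  "times_trm s t = sum_trm (fresh t) s t"

text \<open>In the absence of division, bit \<open>s\<close> of \<open>t\<close> is tested by
  searching for \<open>q\<close> and \<open>r < 2 ^ s\<close> with
  \<open>t = (2 * q + 1) * 2 ^ s + r\<close>. The long search is affordable, as the algorithm
  applies it only to numbers bounded in terms of \<open>d\<close>.\<close>

definition mem_trm :: "trm \<Rightarrow> trm \<Rightarrow> trm" where
  "mem_trm s t = (let x = max (fresh s) (fresh t) in
     ex_trm x (Plus t (Num 1)) (ex_trm (Suc x) (pow2_trm s)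
       (eq_trm t (Plus (times_trm (Plus (Plus (Ref x) (Ref x)) (Num 1)) (pow2_trm s)) (Ref (Suc x))))))"

definition collect_trm :: "nat \<Rightarrow> trm \<Rightarrow> trm \<Rightarrow> trm" where
  "collect_trm x b \<phi> = sum_trm x b (if_trm \<phi> (pow2_trm (Ref x)) (Num 0))"

lemma fv_cond [simp]: "fv (if_trm \<phi> t u) = fv \<phi> \<union> fv t \<union> fv u"
  by (simp add: if_trm_def)

lemma fv_less [simp]: "fv (less_trm s t) = fv s \<union> fv t"
  by (simp add: less_trm_def)

lemma fv_neg [simp]: "fv (neg_trm \<phi>) = fv \<phi>"
  by (simp add: neg_trm_def)

lemma fv_conj [simp]: "fv (conj_trm \<phi> \<psi>) = fv \<phi> \<union> fv \<psi>"
  by (simp add: conj_trm_def)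

lemma fv_disj [simp]: "fv (disj_trm \<phi> \<psi>) = fv \<phi> \<union> fv \<psi>"
  by (simp add: disj_trm_def)

lemma fv_eq [simp]: "fv (eq_trm s t) = fv s \<union> fv t"
  by (auto simp: eq_trm_def)

lemma fv_letin [simp]: "fv (let_trm x s t) = fv s \<union> (fv t - {x})"
  using fresh_not_in_fv[of t "max (fresh t) (Suc x)"] by (auto simp: let_trm_def simp del: fresh_not_in_fv)

lemma fv_total [simp]: "fv (sum_trm x b t) = fv b \<union> (fv t - {x})"
  using fresh_not_in_fv[of t "max (fresh t) (Suc x)"] by (auto simp: sum_trm_def simp del: fresh_not_in_fv)

lemma fv_ex [simp]: "fv (ex_trm x b \<phi>) = fv b \<union> (fv \<phi> - {x})"
  by (simp add: ex_trm_def)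

lemma fv_all [simp]: "fv (all_trm x b \<phi>) = fv b \<union> (fv \<phi> - {x})"
  by (simp add: all_trm_def)

lemma fv_pow2 [simp]: "fv (pow2_trm t) = fv t"
  by (simp add: pow2_trm_def)

lemma fv_times [simp]: "fv (times_trm s t) = fv s \<union> fv t"
  by (simp add: times_trm_def)

lemma fv_mem [simp]: "fv (mem_trm s t) = fv s \<union> fv t"
proof -
  let ?x = "max (fresh s) (fresh t)"
  have "?x \<notin> fv s" "?x \<notin> fv t" "Suc ?x \<notin> fv s" "Suc ?x \<notin> fv t"
    by (intro fresh_not_in_fv; simp)+
  then show ?thesis by (auto simp: mem_trm_def Let_def)
qed

lemma fv_collect [simp]: "fv (collect_trm x b \<phi>) = fv b \<union> (fv \<phi> - {x})"
  by (auto simp: collect_trm_def)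

lemma ev_cond [simp]: "ev A (if_trm \<phi> t u) e = (if holds A \<phi> e then ev A t e else ev A u e)"
  by (simp add: if_trm_def holds_def)

lemma ev_letin [simp]: "ev A (let_trm x s t) e = ev A t (e(x := ev A s e))"
  using fresh_not_in_fv[of t "max (fresh t) (Suc x)"] by (simp add: let_trm_def)

lemma ev_total [simp]: "ev A (sum_trm x b t) e = (\<Sum>i<ev A b e. ev A t (e(x := i)))"
proof -
  let ?a = "max (fresh t) (Suc x)"
  have "?a \<notin> fv t" "?a \<noteq> x" by simp_all
  then have "rec_nat 0 (\<lambda>j y. ev A (Plus (Ref ?a) t) (e(?a := y, x := j))) m = (\<Sum>i<m. ev A t (e(x := i)))" for m
    by (induction m) (simp_all add: fun_upd_twist[of ?a])
  then show ?thesis by (simp add: sum_trm_def)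
qed

lemma ev_pow2 [simp]: "ev A (pow2_trm t) e = 2 ^ ev A t e"
proof -
  have "rec_nat 1 (\<lambda>j y. y + y) m = (2::nat) ^ m" for m by (induction m) auto
  then show ?thesis by (simp add: pow2_trm_def)
qed

lemma ev_times [simp]: "ev A (times_trm s t) e = ev A s e * ev A t e"
  by (simp add: times_trm_def)

lemma ev_less [simp]: "ev A (less_trm s t) e = (if ev A s e < ev A t e then 1 else 0)"
  by (simp add: less_trm_def)

lemma holds_less [simp]: "holds A (less_trm s t) e \<longleftrightarrow> ev A s e < ev A t e"
  by (simp add: holds_def)

lemma holds_neg [simp]: "holds A (neg_trm \<phi>) e \<longleftrightarrow> \<not> holds A \<phi> e"
  unfolding holds_def[of A "neg_trm \<phi>"] by (simp add: neg_trm_def)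

lemma holds_conj [simp]: "holds A (conj_trm \<phi> \<psi>) e \<longleftrightarrow> holds A \<phi> e \<and> holds A \<psi> e"
  unfolding holds_def[of A "conj_trm \<phi> \<psi>"] by (simp add: conj_trm_def) (simp add: holds_def)

lemma holds_disj [simp]: "holds A (disj_trm \<phi> \<psi>) e \<longleftrightarrow> holds A \<phi> e \<or> holds A \<psi> e"
  unfolding holds_def[of A "disj_trm \<phi> \<psi>"] by (simp add: disj_trm_def) (simp add: holds_def)

lemma holds_eq [simp]: "holds A (eq_trm s t) e \<longleftrightarrow> ev A s e = ev A t e"
  by (auto simp: eq_trm_def)

lemma holds_ex [simp]: "holds A (ex_trm x b \<phi>) e \<longleftrightarrow> (\<exists>i<ev A b e. holds A \<phi> (e(x := i)))"
  unfolding holds_def[of A "ex_trm x b \<phi>"] by (auto simp: ex_trm_def)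

lemma holds_all [simp]: "holds A (all_trm x b \<phi>) e \<longleftrightarrow> (\<forall>i<ev A b e. holds A \<phi> (e(x := i)))"
  by (simp add: all_trm_def)

lemma set_decode_iff:
  "a \<in> set_decode s \<longleftrightarrow> (\<exists>q<s + 1. \<exists>r<2 ^ a. s = (q + q + 1) * 2 ^ a + r)"
proof
  assume "a \<in> set_decode s"
  then have "odd (s div 2 ^ a)" by (simp add: set_decode_def)
  then obtain q where q: "s div 2 ^ a = 2 * q + 1" by (rule oddE)
  have "s = (s div 2 ^ a) * 2 ^ a + s mod 2 ^ a"
    by (rule div_mult_mod_eq[symmetric])
  then have "s = (q + q + 1) * 2 ^ a + s mod 2 ^ a" unfolding q by (simp add: mult_2)
  moreover have "q < s + 1" using q div_le_dividend[of s "2 ^ a"] by simp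
  moreover have "s mod 2 ^ a < 2 ^ a" by simp
  ultimately show "\<exists>q<s + 1. \<exists>r<2 ^ a. s = (q + q + 1) * 2 ^ a + r" by blast
next
  assume "\<exists>q<s + 1. \<exists>r<2 ^ a. s = (q + q + 1) * 2 ^ a + r"
  then obtain q r where "r < 2 ^ a" and s: "s = (q + q + 1) * 2 ^ a + r" by blast
  have "s div 2 ^ a = q + q + 1 + r div 2 ^ a" unfolding s by (rule div_mult_self3) simp
  then show "a \<in> set_decode s" using \<open>r < 2 ^ a\<close> by (simp add: set_decode_def)
qed

lemma holds_mem [simp]: "holds A (mem_trm s t) e \<longleftrightarrow> ev A s e \<in> set_decode (ev A t e)"
proof -
  let ?x = "max (fresh s) (fresh t)"
  have "?x \<notin> fv s" "?x \<notin> fv t" "Suc ?x \<notin> fv s" "Suc ?x \<notin> fv t"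
    by (intro fresh_not_in_fv; simp)+
  then show ?thesis
    unfolding set_decode_iff[of "ev A s e"] by (simp add: mem_trm_def Let_def)
qed

lemma ev_collect [simp]:
  "ev A (collect_trm x b \<phi>) e = set_encode {i. i < ev A b e \<and> holds A \<phi> (e(x := i))}"
proof -
  have "ev A (collect_trm x b \<phi>) e = (\<Sum>i<ev A b e. if holds A \<phi> (e(x := i)) then 2 ^ i else 0)"
    by (simp add: collect_trm_def cong: if_cong)
  also have "\<dots> = (\<Sum>i | i < ev A b e \<and> holds A \<phi> (e(x := i)). 2 ^ i)"
    by (intro sum.mono_neutral_cong_right) auto
  finally show ?thesis by (simp add: set_encode_def)
qed

lemma loops_bounded_cond [simp]: "loops_bounded A B (if_trm \<phi> t u) e \<longleftrightarrow> loops_bounded A B \<phi> e \<and>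
    (if holds A \<phi> e then loops_bounded A B t e else loops_bounded A B u e)"
  by (auto simp: if_trm_def holds_def)

lemma loops_bounded_less [simp]:
  "loops_bounded A B (less_trm s t) e \<longleftrightarrow> loops_bounded A B s e \<and> loops_bounded A B t e"
  by (simp add: less_trm_def)

lemma loops_bounded_neg [simp]: "loops_bounded A B (neg_trm \<phi>) e \<longleftrightarrow> loops_bounded A B \<phi> e"
  by (simp add: neg_trm_def)

lemma loops_bounded_conj [simp]: "loops_bounded A B (conj_trm \<phi> \<psi>) e \<longleftrightarrow>
    loops_bounded A B \<phi> e \<and> (holds A \<phi> e \<longrightarrow> loops_bounded A B \<psi> e)"
  by (simp add: conj_trm_def)

lemma loops_bounded_disj [simp]: "loops_bounded A B (disj_trm \<phi> \<psi>) e \<longleftrightarrow>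
    loops_bounded A B \<phi> e \<and> (\<not> holds A \<phi> e \<longrightarrow> loops_bounded A B \<psi> e)"
  by (simp add: disj_trm_def)

lemma loops_bounded_eq [simp]:
  "loops_bounded A B (eq_trm s t) e \<longleftrightarrow> loops_bounded A B s e \<and> loops_bounded A B t e"
  by (auto simp: eq_trm_def)

lemma loops_bounded_letin [simp]: "loops_bounded A B (let_trm x s t) e \<longleftrightarrow>
    1 \<le> B \<and> loops_bounded A B s e \<and> loops_bounded A B t (e(x := ev A s e))"
  using fresh_not_in_fv[of t "max (fresh t) (Suc x)"] by (auto simp: let_trm_def)

lemma loops_bounded_total [simp]: "loops_bounded A B (sum_trm x b t) e \<longleftrightarrow>
    loops_bounded A B b e \<and> ev A b e \<le> B \<and> (\<forall>i<ev A b e. loops_bounded A B t (e(x := i)))"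
proof -
  let ?a = "max (fresh t) (Suc x)"
  have "?a \<notin> fv t" "?a \<noteq> x" by simp_all
  then show ?thesis by (simp add: sum_trm_def fun_upd_twist[of ?a])
qed

lemma loops_bounded_ex [simp]: "loops_bounded A B (ex_trm x b \<phi>) e \<longleftrightarrow>
    loops_bounded A B b e \<and> ev A b e \<le> B \<and> (\<forall>i<ev A b e. loops_bounded A B \<phi> (e(x := i)))"
  by (simp add: ex_trm_def)

lemma loops_bounded_all [simp]: "loops_bounded A B (all_trm x b \<phi>) e \<longleftrightarrow>
    loops_bounded A B b e \<and> ev A b e \<le> B \<and> (\<forall>i<ev A b e. loops_bounded A B \<phi> (e(x := i)))"
  by (simp add: all_trm_def)

lemma loops_bounded_pow2 [simp]:
  "loops_bounded A B (pow2_trm t) e \<longleftrightarrow> loops_bounded A B t e \<and> ev A t e \<le> B"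
  by (auto simp: pow2_trm_def)

lemma loops_bounded_times [simp]: "loops_bounded A B (times_trm s t) e \<longleftrightarrow>
    loops_bounded A B s e \<and> ev A s e \<le> B \<and> (0 < ev A s e \<longrightarrow> loops_bounded A B t e)"
  by (auto simp: times_trm_def)

section \<open>The algorithm as a term\<close>

text \<open>Variables: 0 is \<open>n\<close>, 1 is \<open>k\<close>, 2 is \<open>d\<close>, 3 and 4 are the vertices \<open>u\<close> and \<open>v\<close> of the main loops,
  5 and 6 hold codes of sets of states, 7 a vertex type; larger numbers are local.\<close>

definition rank_trm :: "nat \<Rightarrow> trm" where
  "rank_trm x = sum_trm 10 (Ref x) (if_trm (Get 0 (Ref 10)) (Num 1) (Num 0))"

definition adj_trm :: "nat \<Rightarrow> nat \<Rightarrow> trm" where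
  "adj_trm x y = Get 1 (Plus (times_trm (Ref x) (Ref 0)) (Ref y))"

definition nb_trm :: "bool \<Rightarrow> nat \<Rightarrow> nat \<Rightarrow> trm" where
  "nb_trm cn x y = (if cn then disj_trm (adj_trm x y) (eq_trm (Ref y) (Ref x)) else adj_trm x y)"

text \<open>The exponents are pairwise distinct, so adding powers of two yields the code of the set
  of bits.\<close>

definition vtype_trm :: "bool \<Rightarrow> trm" where
  "vtype_trm cn = sum_trm 11 (Ref 0) (if_trm (Get 0 (Ref 11))
     (Plus (if_trm (nb_trm cn 4 11) (pow2_trm (rank_trm 11)) (Num 0))
       (if_trm (eq_trm (Ref 11) (Ref 4)) (pow2_trm (Plus (Ref 2) (rank_trm 11))) (Num 0))) (Num 0))"

definition types_trm :: trm where
  "types_trm = pow2_trm (times_trm (Num 2) (Ref 2))"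

definition offset_trm :: trm where
  "offset_trm = times_trm (Num 3) (times_trm types_trm (Ref 1))"

definition codes_trm :: trm where
  "codes_trm = pow2_trm (Plus offset_trm offset_trm)"

definition bump_trm :: "trm \<Rightarrow> trm \<Rightarrow> trm" where
  "bump_trm q j = if_trm (mem_trm q j)
     (if_trm (mem_trm (Plus q (Num 1)) j)
       (if_trm (mem_trm (Plus q (Num 2)) j) j (Plus (pow2_trm (Plus q (Num 2))) j))
       (Plus (pow2_trm (Plus q (Num 1))) j))
     (Plus (pow2_trm q) j)"

definition pos_trm :: "trm \<Rightarrow> trm \<Rightarrow> trm" where
  "pos_trm \<tau> c = times_trm (Num 3) (Plus (times_trm \<tau> (Ref 1)) c)"

text \<open>The new set of states is not built by insertions: every possible code is tested for
  being a successor.\<close>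

definition vstep_trm :: trm where
  "vstep_trm = collect_trm 20 codes_trm (ex_trm 21 codes_trm (ex_trm 22 (Ref 1) (conj_trm (mem_trm (Ref 21) (Ref 6))
     (eq_trm (Ref 20) (bump_trm (Plus offset_trm (pos_trm (Ref 7) (Ref 22)))
       (bump_trm (pos_trm (Ref 7) (Ref 22)) (Ref 21)))))))"

definition cnt_trm :: "trm \<Rightarrow> trm \<Rightarrow> trm \<Rightarrow> trm" where
  "cnt_trm b \<sigma> c = sum_trm 30 (Num 3)
     (if_trm (mem_trm (Plus b (Plus (pos_trm \<sigma> c) (Ref 30))) (Ref 21)) (Num 1) (Num 0))"

definition seen_trm :: "trm \<Rightarrow> trm \<Rightarrow> trm" where
  "seen_trm r c = sum_trm 31 types_trm (if_trm (mem_trm r (Ref 31)) (cnt_trm (Num 0) (Ref 31) c) (Num 0))"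

definition in_clique_trm :: "trm \<Rightarrow> trm" where
  "in_clique_trm c = sum_trm 31 (pow2_trm (Ref 2)) (cnt_trm offset_trm (Ref 31) c)"

definition clique_ok_trm :: "bool \<Rightarrow> trm" where
  "clique_ok_trm cn = all_trm 32 (pow2_trm (Ref 2)) (all_trm 33 (Ref 1)
     (disj_trm (neg_trm (mem_trm (Plus offset_trm (pos_trm (Ref 32) (Ref 33))) (Ref 21)))
       (ex_trm 34 (Ref 1) (eq_trm
         (Plus (in_clique_trm (Ref 34))
           (sum_trm 35 (Ref 2) (if_trm (mem_trm (Ref 35) (Ref 32)) (seen_trm (Plus (Ref 2) (Ref 35)) (Ref 34)) (Num 0))))
         (Plus (Num 1) (if cn then Num 0 else if_trm (neg_trm (eq_trm (Ref 34) (Ref 33))) (Num 0) (Num 1)))))))"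

definition modulator_ok_trm :: trm where
  "modulator_ok_trm = all_trm 32 (Ref 2) (ex_trm 34 (Ref 1) (eq_trm (seen_trm (Ref 32) (Ref 34)) (Num 1)))"

definition estep_trm :: "bool \<Rightarrow> trm" where
  "estep_trm cn = collect_trm 20 codes_trm (ex_trm 21 codes_trm (conj_trm (mem_trm (Ref 21) (Ref 6))
     (conj_trm (clique_ok_trm cn) (eq_trm (Ref 20) (collect_trm 23 offset_trm (mem_trm (Ref 23) (Ref 21)))))))"

definition final_trm :: trm where
  "final_trm = ex_trm 21 codes_trm (conj_trm (mem_trm (Ref 21) (Ref 6)) modulator_ok_trm)"

definition modulator_block_trm :: trm where
  "modulator_block_trm = conj_trm (Get 0 (Ref 3)) (eq_trm (Ref 4) (Ref 3))"

definition clique_block_trm :: trm where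
  "clique_block_trm = conj_trm (neg_trm (Get 0 (Ref 3))) (conj_trm (neg_trm (Get 0 (Ref 4)))
     (conj_trm (disj_trm (eq_trm (Ref 3) (Ref 4)) (adj_trm 3 4))
       (all_trm 12 (Ref 3) (disj_trm (Get 0 (Ref 12)) (conj_trm (neg_trm (eq_trm (Ref 12) (Ref 4))) (neg_trm (adj_trm 12 4)))))))"

definition inner_trm :: "bool \<Rightarrow> trm \<Rightarrow> trm" where
  "inner_trm cn blk = Iterate 6 4 (Ref 0) (Ref 5) (if_trm blk (let_trm 7 (vtype_trm cn) vstep_trm) (Ref 6))"

definition phase_trm :: "bool \<Rightarrow> trm \<Rightarrow> trm \<Rightarrow> trm" where
  "phase_trm cn blk s = Iterate 5 3 (Ref 0) s (let_trm 6 (inner_trm cn blk) (estep_trm cn))"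

text \<open>\<open>Num 1\<close> is the code \<open>2 ^ 0\<close> of the set
  \<open>{0}\<close>.\<close>

definition accept_trm :: "bool \<Rightarrow> trm" where
  "accept_trm cn = let_trm 6 (phase_trm cn clique_block_trm (phase_trm cn modulator_block_trm (Num 1)))
     (if_trm final_trm (Num 1) (Num 0))"

definition card_trm :: trm where
  "card_trm = sum_trm 10 (Ref 0) (if_trm (Get 0 (Ref 10)) (Num 1) (Num 0))"

definition main_trm :: "bool \<Rightarrow> trm" where
  "main_trm cn = let_trm 2 card_trm
     (if_trm (less_trm (Ref 1) (Plus (times_trm (Num 2) (Ref 2)) (Num 3))) (accept_trm cn)
       (if cn then Num 1 else less_trm (Num 1) (Ref 0)))"

text \<open>Applied with \<open>set_encode\<close> as \<open>h\<close> and containment in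
  \<open>codes\<close> as \<open>I\<close>: the loops on numbers shadow the recursion on sets of
  states, and the invariant guarantees that the bounded searches see all states.\<close>

lemma rec_nat_image:
  assumes "I a" "\<And>j y. j < m \<Longrightarrow> I y \<Longrightarrow> I (g j y) \<and> f j (h y) = h (g j y)"
  shows "I (rec_nat a g m) \<and> rec_nat (h a) f m = h (rec_nat a g m)"
  using assms(2) by (induction m) (auto simp: assms(1))

lemma ev_bump_trm [simp]: "ev A (bump_trm q j) e = bump (ev A q e) (ev A j e)"
proof -
  have *: "set_encode (insert i (set_decode s)) = (if i \<in> set_decode s then s else 2 ^ i + s)" for i s
    by (auto simp: insert_absorb)
  show ?thesis
    by (simp add: bump_trm_def bump_def raise_def * cong: if_cong)
qed

text \<open>These terms read neither \<open>n\<close> nor a vertex, so \<open>growth\<close> bounds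
  their loops in terms of \<open>k\<close>, \<open>d\<close>, a type and the code of a set of
  states.\<close>

lemma fv_steps:
  "fv vstep_trm \<subseteq> {1, 2, 6, 7}" "fv (estep_trm cn) \<subseteq> {1, 2, 6}" "fv final_trm \<subseteq> {1, 2, 6}"
  by (auto simp: vstep_trm_def estep_trm_def final_trm_def clique_ok_trm_def modulator_ok_trm_def
      codes_trm_def offset_trm_def types_trm_def bump_trm_def pos_trm_def in_clique_trm_def
      seen_trm_def cnt_trm_def)

section \<open>Values of the terms of the algorithm\<close>

context cluster_instance
begin

definition encodes :: "input \<Rightarrow> bool" where
  "encodes A \<longleftrightarrow> (\<forall>i. A 0 i = (if i \<in> X then 1 else 0)) \<and>
     (\<forall>u<n. \<forall>v<n. A 1 (u * n + v) = (if (u, v) \<in> E then 1 else 0)) \<and> (\<forall>a i. A a i \<le> 1)"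

lemma holds_Get_X: "encodes A \<Longrightarrow> holds A (Get 0 t) e \<longleftrightarrow> ev A t e \<in> X"
  by (simp add: holds_def encodes_def)

lemma ev_rank_trm:
  assumes "encodes A"
  shows "ev A (rank_trm x) e = rank (e x)"
proof -
  have "ev A (rank_trm x) e = card ({..<e x} \<inter> X)"
    using assms by (simp add: rank_trm_def holds_Get_X sum.If_cases)
  also have "{..<e x} \<inter> X = {y \<in> X. y < e x}" by auto
  finally show ?thesis by (simp add: rank_def)
qed

lemma holds_adj_trm:
  assumes "encodes A" "e 0 = n" "e x < n" "e y < n"
  shows "holds A (adj_trm x y) e \<longleftrightarrow> (e x, e y) \<in> E"
  using assms by (simp add: adj_trm_def holds_def encodes_def)

lemma holds_nb_trm:
  assumes "encodes A" "e 0 = n" "e x < n" "e y < n"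
  shows "holds A (nb_trm cn x y) e \<longleftrightarrow> e y \<in> nb (e x)"
  unfolding nb_trm_def nb_def using holds_adj_trm[OF assms] by simp

lemma ev_vtype_trm:
  assumes "encodes A" "e 0 = n" "e 4 < n" "e 2 = d"
  shows "ev A (vtype_trm cn) e = vtype (e 4)"
proof -
  let ?v = "e 4"
  have "ev A (vtype_trm cn) e =
    (\<Sum>x<n. if x \<in> X then (if x \<in> nb ?v then 2 ^ rank x else 0) + (if x = ?v then 2 ^ (d + rank x) else 0) else 0)"
    using assms unfolding vtype_trm_def
    by (simp add: holds_nb_trm ev_rank_trm holds_Get_X cong: if_cong)
  also have "\<dots> = (\<Sum>x\<in>X. (if x \<in> nb ?v then 2 ^ rank x else 0) + (if x = ?v then 2 ^ (d + rank x) else 0))"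
    using X_sub by (intro sum.mono_neutral_cong_right) auto
  also have "\<dots> = (\<Sum>x\<in>X \<inter> nb ?v. 2 ^ rank x) + (if ?v \<in> X then 2 ^ (d + rank ?v) else 0)"
    by (simp add: sum.distrib sum.If_cases Int_def cong: if_cong)
  also have "(\<Sum>x\<in>X \<inter> nb ?v. 2 ^ rank x) = set_encode (rank ` (X \<inter> nb ?v))"
    unfolding set_encode_def using bij_rank
    by (subst sum.reindex) (auto simp: bij_betw_def intro: inj_on_subset)
  also have "set_encode (rank ` (X \<inter> nb ?v)) + (if ?v \<in> X then 2 ^ (d + rank ?v) else 0) = vtype ?v"
  proof -
    have "d + rank ?v \<notin> rank ` (X \<inter> nb ?v)" using rank_less by fastforce
    then show ?thesis by (auto simp: vtype_def)
  qed
  finally show ?thesis .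
qed

definition codes :: "nat set" where "codes = {..<2 ^ (6 * L)}"

lemma ev_types_trm: "e 2 = d \<Longrightarrow> ev A types_trm e = 2 ^ (2 * d)"
  by (simp add: types_trm_def)

lemma ev_offset_trm: "e 1 = k \<Longrightarrow> e 2 = d \<Longrightarrow> ev A offset_trm e = 3 * L"
  by (simp add: offset_trm_def ev_types_trm L_def)

lemma ev_codes_trm: "e 1 = k \<Longrightarrow> e 2 = d \<Longrightarrow> ev A codes_trm e = 2 ^ (6 * L)"
  by (simp add: codes_trm_def ev_offset_trm)

lemma ev_pos_trm: "e 1 = k \<Longrightarrow> ev A (pos_trm \<tau> c) e = 3 * (ev A \<tau> e * k + ev A c e)"
  by (simp add: pos_trm_def)

lemma bump_code:
  assumes "j < 2 ^ m" "q + 2 < m"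
  shows "bump q j < 2 ^ m"
proof -
  have "set_decode j \<subseteq> {..<m}" using set_encode_less_power[of "set_decode j" m] assms by simp
  then have "raise q (set_decode j) \<subseteq> {..<m}" using assms by (auto simp: raise_def)
  then show ?thesis by (simp add: bump_def set_encode_less_power)
qed

text \<open>Ensures that a collection bounded by \<open>codes_trm\<close> misses no
  successor.\<close>

lemma vstep_codes:
  assumes "S \<subseteq> codes" "\<tau> < 2 ^ (2 * d)"
  shows "vstep \<tau> S \<subseteq> codes"
proof -
  have "bump (3 * L + 3 * (\<tau> * k + c)) (bump (3 * (\<tau> * k + c)) j) < 2 ^ (6 * L)"
    if "j \<in> S" "c < k" for j c
  proof -
    have "\<tau> * k + c < L" using key_less assms(2) that(2) by blast
    then show ?thesis using assms(1) that(1) by (intro bump_code) (auto simp: codes_def)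
  qed
  then show ?thesis by (auto simp: vstep_def codes_def)
qed

lemma estep_codes: "estep S \<subseteq> codes"
  by (auto simp: estep_def codes_def set_encode_less_power)

lemma ev_vstep_trm:
  assumes "e 1 = k" "e 2 = d" "e 6 = set_encode S" "S \<subseteq> codes" "e 7 < 2 ^ (2 * d)"
  shows "ev A vstep_trm e = set_encode (vstep (e 7) S)"
proof -
  have "finite S" using assms(4) finite_subset by (auto simp: codes_def)
  then have "ev A vstep_trm e = set_encode {j'. j' < 2 ^ (6 * L) \<and> (\<exists>j<2 ^ (6 * L). \<exists>c<k. j \<in> S \<and>
      j' = bump (3 * L + 3 * (e 7 * k + c)) (bump (3 * (e 7 * k + c)) j))}"
    using assms(1-3) by (simp add: vstep_trm_def ev_codes_trm ev_offset_trm ev_pos_trm)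
  also have "{j'. j' < 2 ^ (6 * L) \<and> (\<exists>j<2 ^ (6 * L). \<exists>c<k. j \<in> S \<and>
      j' = bump (3 * L + 3 * (e 7 * k + c)) (bump (3 * (e 7 * k + c)) j))} = vstep (e 7) S"
    using vstep_codes[OF assms(4,5)] assms(4) unfolding vstep_def codes_def by blast
  finally show ?thesis .
qed

lemma ev_cnt_trm:
  assumes "e 1 = k" "30 \<notin> fv b \<union> fv \<sigma> \<union> fv c"
  shows "ev A (cnt_trm b \<sigma> c) e = cnt (e 21) (ev A b e) (ev A \<sigma> e) (ev A c e)"
  using assms by (simp add: cnt_trm_def cnt_def ev_pos_trm cong: if_cong)

lemma ev_seen_trm:
  assumes "e 1 = k" "e 2 = d" "{30, 31} \<inter> (fv r \<union> fv c) = {}"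
  shows "ev A (seen_trm r c) e = seen (e 21) (ev A r e) (ev A c e)"
  using assms by (simp add: seen_trm_def seen_def ev_types_trm ev_cnt_trm cong: if_cong)

lemma ev_in_clique_trm:
  assumes "e 1 = k" "e 2 = d" "{30, 31} \<inter> fv c = {}"
  shows "ev A (in_clique_trm c) e = in_clique (e 21) (ev A c e)"
proof -
  have "30 \<notin> fv offset_trm" by (simp add: offset_trm_def types_trm_def)
  with assms show ?thesis by (simp add: in_clique_trm_def in_clique_def ev_offset_trm ev_cnt_trm)
qed

lemma holds_clique_ok_trm:
  assumes "e 1 = k" "e 2 = d"
  shows "holds A (clique_ok_trm cn) e \<longleftrightarrow> clique_ok (e 21)"
  unfolding clique_ok_trm_def clique_ok_def using assms
  by (cases cn) (simp_all add: ev_offset_trm ev_pos_trm ev_in_clique_trm ev_seen_trm cong: if_cong split del: if_split)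

lemma holds_modulator_ok_trm:
  assumes "e 1 = k" "e 2 = d"
  shows "holds A modulator_ok_trm e \<longleftrightarrow> modulator_ok (e 21)"
  using assms by (simp add: modulator_ok_trm_def modulator_ok_def ev_seen_trm)

lemma ev_estep_trm:
  assumes "e 1 = k" "e 2 = d" "e 6 = set_encode S" "S \<subseteq> codes"
  shows "ev A (estep_trm cn) e = set_encode (estep S)"
proof -
  have *: "{i. i < 3 * L \<and> i \<in> set_decode j} = set_decode j \<inter> {..<3 * L}" for j by auto
  have "finite S" using assms(4) finite_subset by (auto simp: codes_def)
  then have "ev A (estep_trm cn) e = set_encode {j'. j' < 2 ^ (6 * L) \<and> (\<exists>j<2 ^ (6 * L). j \<in> S \<and>
      clique_ok j \<and> j' = set_encode (set_decode j \<inter> {..<3 * L}))}"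
    using assms(1-3)
    by (simp add: estep_trm_def ev_codes_trm ev_offset_trm holds_clique_ok_trm *)
  also have "{j'. j' < 2 ^ (6 * L) \<and> (\<exists>j<2 ^ (6 * L). j \<in> S \<and>
      clique_ok j \<and> j' = set_encode (set_decode j \<inter> {..<3 * L}))} = estep S"
    using estep_codes[of S] assms(4) unfolding estep_def codes_def by blast
  finally show ?thesis .
qed

lemma holds_final_trm:
  assumes "e 1 = k" "e 2 = d" "e 6 = set_encode S" "S \<subseteq> codes"
  shows "holds A final_trm e \<longleftrightarrow> (\<exists>j\<in>S. modulator_ok j)"
proof -
  have "finite S" using assms(4) finite_subset by (auto simp: codes_def)
  then have "holds A final_trm e \<longleftrightarrow> (\<exists>j<2 ^ (6 * L). j \<in> S \<and> modulator_ok j)"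
    using assms(1-3) by (simp add: final_trm_def ev_codes_trm holds_modulator_ok_trm)
  then show ?thesis using assms(4) by (auto simp: codes_def)
qed

end

context cluster_instance
begin

lemma holds_modulator_block_trm:
  assumes "encodes A"
  shows "holds A modulator_block_trm e \<longleftrightarrow> modulator_block (e 3) (e 4)"
  using assms by (simp add: modulator_block_trm_def modulator_block_def holds_Get_X)

lemma holds_clique_block_trm:
  assumes "encodes A" "e 0 = n" "e 3 < n" "e 4 < n"
  shows "holds A clique_block_trm e \<longleftrightarrow> clique_block (e 3) (e 4)"
  using assms by (simp add: clique_block_trm_def clique_block_def holds_Get_X holds_adj_trm)

abbreviation inner_steps :: "(nat \<Rightarrow> bool) \<Rightarrow> nat set \<Rightarrow> nat \<Rightarrow> nat set" where
  "inner_steps blk S m \<equiv> rec_nat S (\<lambda>v S. if blk v then vstep (vtype v) S else S) m"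

abbreviation outer_steps :: "(nat \<Rightarrow> nat \<Rightarrow> bool) \<Rightarrow> nat set \<Rightarrow> nat \<Rightarrow> nat set" where
  "outer_steps blk S m \<equiv> rec_nat S (\<lambda>u S. estep (inner_steps (blk u) S n)) m"

definition represents_block :: "input \<Rightarrow> trm \<Rightarrow> (nat \<Rightarrow> nat \<Rightarrow> bool) \<Rightarrow> bool" where
  "represents_block A bt blk \<longleftrightarrow>
     (\<forall>e. e 0 = n \<longrightarrow> e 3 < n \<longrightarrow> e 4 < n \<longrightarrow> holds A bt e = blk (e 3) (e 4))"

lemma represents_blocks:
  assumes "encodes A"
  shows "represents_block A modulator_block_trm modulator_block"
    "represents_block A clique_block_trm clique_block"
  using assms by (simp_all add: represents_block_def holds_modulator_block_trm holds_clique_block_trm)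

text \<open>Stated for every prefix \<open>m\<close> and not only for the whole loop, because
  bounding the loops nested inside requires the accumulator of each round.\<close>

lemma inner_values:
  assumes "encodes A" "e 0 = n" "e 1 = k" "e 2 = d" "e 3 < n" "S \<subseteq> codes"
    and bt: "represents_block A bt blk" and "m \<le> n"
  shows "inner_steps (blk (e 3)) S m \<subseteq> codes \<and>
    rec_nat (set_encode S) (\<lambda>j y. ev A (if_trm bt (let_trm 7 (vtype_trm cn) vstep_trm) (Ref 6)) (e(6 := y, 4 := j))) m =
    set_encode (inner_steps (blk (e 3)) S m)"
proof (rule rec_nat_image)
  fix j S' assume j: "j < m" and S': "S' \<subseteq> codes"
  let ?e = "e(6 := set_encode S', 4 := j)"
  have "holds A bt ?e = blk (e 3) j"
    using bt[unfolded represents_block_def, rule_format, of ?e] assms j by simp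
  moreover have "ev A (vtype_trm cn) ?e = vtype j"
    using ev_vtype_trm[of A ?e] assms j by simp
  moreover have "ev A vstep_trm (?e(7 := vtype j)) = set_encode (vstep (vtype j) S')"
    using ev_vstep_trm[of "?e(7 := vtype j)" S'] assms S' vtype_less by simp
  ultimately show "(if blk (e 3) j then vstep (vtype j) S' else S') \<subseteq> codes \<and>
    ev A (if_trm bt (let_trm 7 (vtype_trm cn) vstep_trm) (Ref 6)) ?e =
      set_encode (if blk (e 3) j then vstep (vtype j) S' else S')"
    using S' vstep_codes[OF S' vtype_less] by simp
qed fact

lemma ev_inner_trm:
  assumes "encodes A" "e 0 = n" "e 1 = k" "e 2 = d" "e 3 < n" "e 5 = set_encode S" "S \<subseteq> codes"
    and "represents_block A bt blk"
  shows "ev A (inner_trm cn bt) e = set_encode (inner_steps (blk (e 3)) S n)"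
  using inner_values[OF assms(1-5,7,8) order_refl] assms by (simp add: inner_trm_def)

lemma outer_values:
  assumes "encodes A" "e 0 = n" "e 1 = k" "e 2 = d" "S \<subseteq> codes"
    and bt: "represents_block A bt blk" and "m \<le> n"
  shows "outer_steps blk S m \<subseteq> codes \<and>
    rec_nat (set_encode S) (\<lambda>j y. ev A (let_trm 6 (inner_trm cn bt) (estep_trm cn)) (e(5 := y, 3 := j))) m =
    set_encode (outer_steps blk S m)"
proof (rule rec_nat_image)
  fix j S' assume j: "j < m" and S': "S' \<subseteq> codes"
  let ?e = "e(5 := set_encode S', 3 := j)"
  have "ev A (inner_trm cn bt) ?e = set_encode (inner_steps (blk j) S' n)"
    using ev_inner_trm[of A ?e S' bt blk] assms j S' by simp
  moreover have "inner_steps (blk j) S' n \<subseteq> codes"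
    using inner_values[of A ?e S' bt blk n] assms j S' by simp
  ultimately show "estep (inner_steps (blk j) S' n) \<subseteq> codes \<and>
    ev A (let_trm 6 (inner_trm cn bt) (estep_trm cn)) ?e = set_encode (estep (inner_steps (blk j) S' n))"
    using ev_estep_trm[of "?e(6 := set_encode (inner_steps (blk j) S' n))" "inner_steps (blk j) S' n" A]
      assms estep_codes by simp
qed fact

lemma ev_phase_trm:
  assumes "encodes A" "e 0 = n" "e 1 = k" "e 2 = d" "ev A s e = set_encode S" "S \<subseteq> codes"
    and "represents_block A bt blk"
  shows "ev A (phase_trm cn bt s) e = set_encode (phase blk S)" "phase blk S \<subseteq> codes"
  using outer_values[OF assms(1-4,6,7) order_refl] assms by (simp_all add: phase_trm_def phase_def)

lemma initial_codes: "{0} \<subseteq> codes"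
  by (simp add: codes_def)

lemma ev_phases:
  assumes "encodes A" "e 0 = n" "e 1 = k" "e 2 = d"
  shows "ev A (phase_trm cn clique_block_trm (phase_trm cn modulator_block_trm (Num 1))) e =
      set_encode (phase clique_block (phase modulator_block {0}))"
    "phase clique_block (phase modulator_block {0}) \<subseteq> codes"
proof -
  have "ev A (Num 1) e = set_encode {0}" by (simp add: set_encode_def)
  note 1 = ev_phase_trm[OF assms this initial_codes represents_blocks(1)[OF assms(1)]]
  from ev_phase_trm[OF assms 1 represents_blocks(2)[OF assms(1)]]
  show "ev A (phase_trm cn clique_block_trm (phase_trm cn modulator_block_trm (Num 1))) e =
      set_encode (phase clique_block (phase modulator_block {0}))"
    "phase clique_block (phase modulator_block {0}) \<subseteq> codes" by auto
qed

lemma ev_accept_trm: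
  assumes "encodes A" "e 0 = n" "e 1 = k" "e 2 = d"
  shows "ev A (accept_trm cn) e = (if accepted then 1 else 0)"
proof -
  let ?S = "phase clique_block (phase modulator_block {0})"
  have "holds A final_trm (e(6 := set_encode ?S)) \<longleftrightarrow> accepted"
    unfolding accepted_def by (rule holds_final_trm[OF _ _ _ ev_phases(2)[OF assms]]) (use assms in auto)
  then show ?thesis unfolding accept_trm_def ev_letin ev_phases(1)[OF assms] by simp
qed

lemma ev_card_X:
  assumes "encodes A" "e 0 = n"
  shows "ev A card_trm e = d"
proof -
  have "{..<n} \<inter> X = X" using X_sub by auto
  then show ?thesis using assms by (simp add: card_trm_def holds_Get_X sum.If_cases d_def)
qed

lemma ev_main_trm:
  assumes "encodes A" "e 0 = n" "e 1 = k"
  shows "ev A (main_trm cn) e =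
    (if k < 2 * d + 3 then if accepted then 1 else 0 else if cn \<or> 1 < n then 1 else 0)"
  using ev_accept_trm[OF assms(1), of "e(2 := d)"] assms
  by (simp add: main_trm_def ev_card_X)


section \<open>Lengths of the loops of the algorithm\<close>

definition admissible :: "nat \<Rightarrow> nat \<Rightarrow> bool" where
  "admissible b B \<longleftrightarrow> k \<le> b \<and> d \<le> b \<and> 2 ^ (2 * d) \<le> b \<and> 2 ^ (2 ^ (6 * L)) \<le> b \<and>
     growth vstep_trm b \<le> B \<and> growth (estep_trm cn) b \<le> B \<and> growth final_trm b \<le> B"

text \<open>The source of the double exponential in \<open>admissible\<close>: a set of codes below
  \<open>2 ^ (6 * L)\<close> is coded by a number below \<open>2 ^ (2 ^ (6 * L))\<close>. There
  \<open>b\<close> bounds values and \<open>B\<close> loop lengths.\<close>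

lemma code_of_codes_le: "admissible b B \<Longrightarrow> S \<subseteq> codes \<Longrightarrow> set_encode S \<le> b"
proof -
  assume *: "admissible b B" "S \<subseteq> codes"
  then have "set_encode S < 2 ^ (2 ^ (6 * L))"
    by (subst set_encode_less_power) (auto simp: codes_def intro: finite_subset)
  also have "\<dots> \<le> b" using * by (simp add: admissible_def)
  finally show ?thesis by simp
qed

lemma loops_vstep:
  assumes "encodes A" "admissible b B" "e 1 = k" "e 2 = d" "e 6 = set_encode S" "S \<subseteq> codes" "e 7 < 2 ^ (2 * d)"
  shows "loops_bounded A B vstep_trm e"
proof -
  have "\<forall>x\<in>{1, 2, 6, 7}. e x \<le> b"
    using assms code_of_codes_le[OF assms(2,6)] by (auto simp: admissible_def)
  then have "loops_bounded A (growth vstep_trm b) vstep_trm e"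
    using growth_bounds[of vstep_trm e b A] fv_steps(1) assms(1) by (auto simp: encodes_def)
  then show ?thesis using assms(2) loops_bounded_mono by (auto simp: admissible_def)
qed

lemma loops_estep:
  assumes "encodes A" "admissible b B" "e 1 = k" "e 2 = d" "e 6 = set_encode S" "S \<subseteq> codes"
  shows "loops_bounded A B (estep_trm cn) e" "loops_bounded A B final_trm e"
proof -
  have *: "\<forall>x\<in>{1, 2, 6}. e x \<le> b"
    using assms code_of_codes_le[OF assms(2,6)] by (auto simp: admissible_def)
  then have "loops_bounded A (growth (estep_trm cn) b) (estep_trm cn) e"
    using growth_bounds[of "estep_trm cn" e b A] fv_steps(2) assms(1) by (auto simp: encodes_def)
  then show "loops_bounded A B (estep_trm cn) e"
    using assms(2) loops_bounded_mono by (auto simp: admissible_def)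
  from * have "loops_bounded A (growth final_trm b) final_trm e"
    using growth_bounds[of final_trm e b A] fv_steps(3) assms(1) by (auto simp: encodes_def)
  then show "loops_bounded A B final_trm e"
    using assms(2) loops_bounded_mono by (auto simp: admissible_def)
qed

lemma loops_adj:
  "e x \<le> B \<Longrightarrow> loops_bounded A B (adj_trm x y) e"
  by (simp add: adj_trm_def)

text \<open>Here \<open>n\<close> enters, so the lengths are checked by hand: the loops run through
  all vertices, through the numbers below a vertex, or up to an exponent of at most
  \<open>2 * d\<close>.\<close>

lemma loops_vtype:
  assumes "encodes A" "e 0 = n" "e 4 < n" "e 2 = d" "n + 2 * d \<le> B"
  shows "loops_bounded A B (vtype_trm cn) e"
proof -
  have r: "rank i \<le> d" if "i \<in> X" for i using rank_less[OF that] by simp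
  have "loops_bounded A B (nb_trm cn 4 11) (e(11 := i))" for i
    using assms by (simp add: nb_trm_def loops_adj)
  moreover have "loops_bounded A B (rank_trm 11) (e(11 := i))" if "i < n" for i
    using assms that by (simp add: rank_trm_def)
  ultimately show ?thesis
    using assms by (auto simp: vtype_trm_def holds_Get_X ev_rank_trm dest!: r intro: order_trans)
qed

lemma loops_modulator_block: "loops_bounded A B modulator_block_trm e"
  by (simp add: modulator_block_trm_def)

lemma loops_clique_block: "e 3 \<le> B \<Longrightarrow> loops_bounded A B clique_block_trm e"
  by (auto simp: clique_block_trm_def loops_adj)

lemma loops_inner:
  assumes "encodes A" "e 0 = n" "e 1 = k" "e 2 = d" "e 3 < n" "e 5 = set_encode S" "S \<subseteq> codes"
    and bt: "represents_block A bt blk" "\<And>e. e 3 \<le> B \<Longrightarrow> loops_bounded A B bt e"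
    and B: "admissible b B" "n + 2 * d \<le> B"
  shows "loops_bounded A B (inner_trm cn bt) e"
proof -
  have body: "loops_bounded A B (if_trm bt (let_trm 7 (vtype_trm cn) vstep_trm) (Ref 6))
      (e(6 := rec_nat (set_encode S) (\<lambda>j y. ev A (if_trm bt (let_trm 7 (vtype_trm cn) vstep_trm) (Ref 6)) (e(6 := y, 4 := j))) j, 4 := j))"
    if j: "j < n" for j
  proof -
    define S' where "S' = inner_steps (blk (e 3)) S j"
    have S': "S' \<subseteq> codes"
      "rec_nat (set_encode S) (\<lambda>j y. ev A (if_trm bt (let_trm 7 (vtype_trm cn) vstep_trm) (Ref 6)) (e(6 := y, 4 := j))) j = set_encode S'"
      using inner_values[OF assms(1-5,7) bt(1), of j] j by (simp_all add: S'_def)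
    let ?e = "e(6 := set_encode S', 4 := j)"
    have "loops_bounded A B (vtype_trm cn) ?e"
      by (rule loops_vtype) (use assms j in auto)
    moreover have "ev A (vtype_trm cn) ?e = vtype j"
      using ev_vtype_trm[of A ?e] assms j by simp
    moreover have "loops_bounded A B vstep_trm (?e(7 := vtype j))"
      by (rule loops_vstep[OF assms(1) B(1) _ _ _ S'(1)]) (use assms vtype_less in auto)
    moreover have "loops_bounded A B bt ?e" using bt(2) assms by simp
    ultimately show ?thesis unfolding S'(2) using assms j by simp
  qed
  show ?thesis
    unfolding inner_trm_def loops_bounded.simps ev.simps(2) assms(2,6)
    by (intro conjI allI impI body) (use assms in simp_all)
qed

lemma loops_phase:
  assumes "encodes A" "e 0 = n" "e 1 = k" "e 2 = d" "ev A s e = set_encode S" "S \<subseteq> codes"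
    and s: "loops_bounded A B s e"
    and bt: "represents_block A bt blk" "\<And>e. e 3 \<le> B \<Longrightarrow> loops_bounded A B bt e"
    and B: "admissible b B" "n + 2 * d \<le> B"
  shows "loops_bounded A B (phase_trm cn bt s) e"
proof -
  have "loops_bounded A B (let_trm 6 (inner_trm cn bt) (estep_trm cn))
      (e(5 := rec_nat (set_encode S) (\<lambda>j y. ev A (let_trm 6 (inner_trm cn bt) (estep_trm cn)) (e(5 := y, 3 := j))) j, 3 := j))"
    if j: "j < n" for j
  proof -
    define S' where "S' = outer_steps blk S j"
    have S': "S' \<subseteq> codes"
      "rec_nat (set_encode S) (\<lambda>j y. ev A (let_trm 6 (inner_trm cn bt) (estep_trm cn)) (e(5 := y, 3 := j))) j = set_encode S'"
      using outer_values[OF assms(1-4,6) bt(1), of j] j by (simp_all add: S'_def)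
    let ?e = "e(5 := set_encode S', 3 := j)"
    have "loops_bounded A B (inner_trm cn bt) ?e"
      by (rule loops_inner[OF _ _ _ _ _ _ S'(1) bt B]) (use assms j in auto)
    moreover have "ev A (inner_trm cn bt) ?e = set_encode (inner_steps (blk j) S' n)"
      using ev_inner_trm[of A ?e S' bt blk] assms j S' by simp
    moreover have "inner_steps (blk j) S' n \<subseteq> codes"
      using inner_values[of A ?e S' bt blk n] assms j S' by simp
    then have "loops_bounded A B (estep_trm cn) (?e(6 := set_encode (inner_steps (blk j) S' n)))"
      by (intro loops_estep(1)[OF assms(1) B(1)]) (use assms in auto)
    ultimately show ?thesis unfolding S'(2) using assms j by simp
  qed
  then show ?thesis using assms by (simp add: phase_trm_def)
qed

lemma loops_accept:
  assumes "encodes A" "e 0 = n" "e 1 = k" "e 2 = d" "1 \<le> n"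
    and B: "admissible b B" "n + 2 * d \<le> B"
  shows "loops_bounded A B (accept_trm cn) e"
proof -
  have 0: "ev A (Num 1) e = set_encode {0}" by (simp add: set_encode_def)
  note 1 = ev_phase_trm[OF assms(1-4) 0 initial_codes represents_blocks(1)[OF assms(1)]]
  have 2: "loops_bounded A B (phase_trm cn modulator_block_trm (Num 1)) e"
    by (rule loops_phase[OF assms(1-4) 0 initial_codes _ represents_blocks(1)[OF assms(1)] _ B])
      (simp_all add: loops_modulator_block)
  have 3: "loops_bounded A B (phase_trm cn clique_block_trm (phase_trm cn modulator_block_trm (Num 1))) e"
    by (rule loops_phase[OF assms(1-4) 1 2 represents_blocks(2)[OF assms(1)] loops_clique_block B])
  have "loops_bounded A B final_trm (e(6 := set_encode (phase clique_block (phase modulator_block {0}))))"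
    by (rule loops_estep(2)[OF assms(1) B(1) _ _ _ ev_phases(2)[OF assms(1-4)]]) (use assms in auto)
  with 3 show ?thesis
    unfolding accept_trm_def loops_bounded_letin ev_phases(1)[OF assms(1-4)] using assms by simp
qed

text \<open>The dynamic program is executed only below the threshold, so \<open>admissible\<close>
  is demanded only there.\<close>

lemma loops_main:
  assumes "encodes A" "e 0 = n" "e 1 = k" "1 \<le> n"
    and B: "k < 2 * d + 3 \<Longrightarrow> admissible b B" "n + 2 * d + 3 \<le> B"
  shows "loops_bounded A B (main_trm cn) e"
proof -
  have "loops_bounded A B (accept_trm cn) (e(2 := d))" if "k < 2 * d + 3"
    by (rule loops_accept[OF assms(1) _ _ _ assms(4) B(1)[OF that]]) (use assms in auto)
  moreover have "loops_bounded A B card_trm e" using assms by (simp add: card_trm_def)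
  ultimately show ?thesis using assms by (simp add: main_trm_def ev_card_X)
qed

end

section \<open>Correctness and running time\<close>

definition conflict_free_coloring :: "bool \<Rightarrow> 'a pair_pre_digraph \<Rightarrow> int \<Rightarrow> ('a \<Rightarrow> int) \<Rightarrow> bool" where
  "conflict_free_coloring cn G k C = (if cn then cf_cn_coloring G k C else cf_on_coloring G k C)"

text \<open>The parts containing \<open>v\<close> coincide by disjointness, so \<open>u\<close> and
  \<open>w\<close> share a part.\<close>

lemma cluster_modulator_trans:
  assumes X: "cluster_modulator G X" and V: "u \<in> pverts G - X" "v \<in> pverts G - X" "w \<in> pverts G - X"
    and E: "(u, v) \<in> parcs G" "(v, w) \<in> parcs G" and "u \<noteq> w"
  shows "(u, w) \<in> parcs G"
proof -
  let ?H = "with_proj G \<restriction> (pverts G - X)"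
  have arcs: "arcs_ends ?H = {(x, y) \<in> parcs G. x \<in> pverts G - X \<and> y \<in> pverts G - X}"
    by (auto simp: arcs_ends_def arc_to_ends_def)
  from X obtain P where P: "partition_on (pverts G - X) P"
    and H: "arcs_ends ?H = (\<Union>K\<in>P. {(u, v). u \<in> K \<and> v \<in> K \<and> u \<noteq> v})"
    unfolding cluster_modulator_def cluster_graph_def by auto
  have iff: "(x, y) \<in> parcs G \<longleftrightarrow> (\<exists>K\<in>P. x \<in> K \<and> y \<in> K \<and> x \<noteq> y)"
    if "x \<in> pverts G - X" "y \<in> pverts G - X" for x y
  proof -
    have "(x, y) \<in> parcs G \<longleftrightarrow> (x, y) \<in> arcs_ends ?H" unfolding arcs using that by simp
    then show ?thesis unfolding H by simp
  qed
  obtain K where K: "K \<in> P" "u \<in> K" "v \<in> K" using iff[of u v] V E by auto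
  obtain K' where K': "K' \<in> P" "v \<in> K'" "w \<in> K'" using iff[of v w] V E by auto
  have "K = K'" using P K K' by (auto simp: partition_on_def disjoint_def)
  then show ?thesis using iff[of u w] V K K' \<open>u \<noteq> w\<close> by auto
qed

text \<open>A walk from \<open>v\<close> to \<open>u\<close> has a first arc; as the graph is
  symmetric, the symmetrization in the definition of connectedness adds no arcs.\<close>

lemma connected_has_neighbor:
  assumes G: "pair_graph G" and conn: "Digraph_Component.connected (with_proj G)"
    and v: "v \<in> pverts G" "u \<in> pverts G" "u \<noteq> v"
  shows "\<exists>w. (v, w) \<in> parcs G"
proof -
  interpret pair_graph G by fact
  have "v \<rightarrow>\<^sup>*\<^bsub>with_proj (mk_symmetric (with_proj G))\<^esub> u"
    using conn v unfolding Digraph_Component.connected_def strongly_connected_def by simp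
  then have "v \<rightarrow>\<^sup>*\<^bsub>with_proj G\<^esub> u"
    using reachable_mk_symmetric_eq pair_sym_arcs by blast
  then have "(v, u) \<in> (parcs G)\<^sup>*"
    unfolding reachable_def with_proj_simps by (rule rtrancl_on_rtranclI)
  then show ?thesis using v(3) by (metis converse_rtranclE)
qed

section \<open>From inputs to instances of the dynamic program\<close>

locale cf_instance =
  fixes G :: "nat pair_pre_digraph" and X :: "nat set" and k :: int and cn :: bool
  assumes input: "(G, X, k) \<in> cf_inputs"
begin

definition n :: nat where "n = card (pverts G)"

lemma graph: "pair_graph G" and connected: "Digraph_Component.connected (with_proj G)"
  and modulator: "cluster_modulator G X"
  using input by (auto simp: cf_inputs_def)

lemma pverts: "pverts G = {..<n}"
proof -
  obtain m where "pverts G = {..<m}" using input by (auto simp: cf_inputs_def)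
  then show ?thesis by (simp add: n_def)
qed

lemma n_pos: "1 \<le> n"
  using connected pverts by (cases n) (auto simp: Digraph_Component.connected_def strongly_connected_def)

lemma X_sub: "X \<subseteq> {..<n}"
  using modulator pverts by (auto simp: cluster_modulator_def)

sublocale graph: pair_graph G by (rule graph)

text \<open>\<open>nat k\<close> is adequate for negative \<open>k\<close> too, as no color is
  available either way.\<close>

sublocale cluster_instance n X "parcs G" cn "nat k"
proof
  show "X \<subseteq> {..<n}" by (rule X_sub)
  show sub: "parcs G \<subseteq> {..<n} \<times> {..<n}"
    using graph.in_arcsD1 graph.in_arcsD2 pverts by auto
  show "(u, v) \<in> parcs G \<Longrightarrow> (v, u) \<in> parcs G" for u v
    using graph.pair_sym_arcs by (auto simp: symmetric_def dest: symD)
  show "(v, v) \<notin> parcs G" for v using graph.pair_no_loops by fastforce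
  show "(u, w) \<in> parcs G"
    if "(u, v) \<in> parcs G" "(v, w) \<in> parcs G" "u \<notin> X" "v \<notin> X" "w \<notin> X" "u \<noteq> w" for u v w
    using cluster_modulator_trans[OF modulator] that sub pverts by blast
qed

lemma parcs_verts: "(u, v) \<in> parcs G \<Longrightarrow> u < n \<and> v < n"
  using E_sub by auto

lemma nb_eq: "v < n \<Longrightarrow> nb v = (if cn then closed_neighborhood G v else open_neighborhood G v)"
  using parcs_verts by (auto simp: nb_def closed_neighborhood_def open_neighborhood_def pverts)

lemma conflict_free_coloring_iff:
  "conflict_free_coloring cn G k C \<longleftrightarrow> C \<in> {..<n} \<rightarrow> {1..k} \<and> (\<forall>v<n. has_unique_color C (nb v))"
  using nb_eq by (auto simp: conflict_free_coloring_def cf_cn_coloring_def cf_on_coloring_def pverts)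

lemma ex_coloring_iff:
  "(\<exists>C. conflict_free_coloring cn G k C) \<longleftrightarrow> (\<exists>C\<in>{..<n} \<rightarrow> {..<nat k}. \<forall>v<n. uniq C v)"
proof
  assume "\<exists>C. conflict_free_coloring cn G k C"
  then obtain C where C: "C \<in> {..<n} \<rightarrow> {1..k}" "\<And>v. v < n \<Longrightarrow> has_unique_color C (nb v)"
    unfolding conflict_free_coloring_iff by blast
  define C' where "C' v = nat (C v - 1)" for v
  have "uniq C' v" if v: "v < n" for v
  proof -
    obtain c where c: "card {u \<in> nb v. C u = c} = 1" using C(2)[OF v] by (auto simp: has_unique_color_def)
    then obtain z where "{u \<in> nb v. C u = c} = {z}" by (meson card_1_singletonE)
    then have z: "z \<in> nb v" "C z = c" by auto
    \<comment> \<open>Since colors are at least 1, the truncating shift in \<open>C'\<close> merges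
      no two of them on \<open>nb v\<close>.\<close>
    have pos: "1 \<le> C u" if "u \<in> nb v" for u using C(1) nb_sub[OF v] that by fastforce
    have "C' u = nat (c - 1) \<longleftrightarrow> C u = c" if "u \<in> nb v" for u
      using pos[OF that] pos[OF z(1)] z(2) by (auto simp: C'_def)
    then have "{u \<in> nb v. C' u = nat (c - 1)} = {u \<in> nb v. C u = c}" by blast
    with c show ?thesis unfolding uniq_def by metis
  qed
  moreover have "C' v < nat k" if "v < n" for v
    using C(1) that by (fastforce simp: C'_def Pi_def)
  ultimately show "\<exists>C\<in>{..<n} \<rightarrow> {..<nat k}. \<forall>v<n. uniq C v" by (intro bexI[of _ C']) auto
next
  assume "\<exists>C\<in>{..<n} \<rightarrow> {..<nat k}. \<forall>v<n. uniq C v"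
  then obtain C where C: "C \<in> {..<n} \<rightarrow> {..<nat k}" "\<And>v. v < n \<Longrightarrow> uniq C v" by blast
  define C' where "C' v = int (C v) + 1" for v
  have "has_unique_color C' (nb v)" if v: "v < n" for v
  proof -
    obtain c where c: "card {u \<in> nb v. C u = c} = 1" using C(2)[OF v] by (auto simp: uniq_def)
    have "{u \<in> nb v. C' u = int c + 1} = {u \<in> nb v. C u = c}" by (auto simp: C'_def)
    with c show ?thesis unfolding has_unique_color_def by metis
  qed
  moreover have "C' v \<in> {1..k}" if "v < n" for v
    using C(1) that by (fastforce simp: C'_def Pi_def)
  ultimately show "\<exists>C. conflict_free_coloring cn G k C" unfolding conflict_free_coloring_iff by blast
qed

text \<open>At or above the threshold, connectedness supplies the neighbors that
  \<open>many_colors\<close> asks for, unless neighborhoods are open and there is a single vertex,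
  whose neighborhood is empty.\<close>

lemma answer:
  "(if nat k < 2 * d + 3 then if accepted then 1 else 0 else if cn \<or> 1 < n then 1 else 0) =
    (if \<exists>C. conflict_free_coloring cn G k C then 1 else 0)"
proof (cases "nat k < 2 * d + 3")
  case True
  then show ?thesis using accepted_iff ex_coloring_iff by simp
next
  case False
  have "(\<exists>C\<in>{..<n} \<rightarrow> {..<nat k}. \<forall>v<n. uniq C v) \<longleftrightarrow> cn \<or> 1 < n"
  proof (cases "cn \<or> 1 < n")
    case True
    have "nb v \<noteq> {}" if v: "v < n" for v
    proof (cases cn)
      case False
      with True have "(if v = 0 then 1 else 0) \<in> pverts G" "(if v = 0 then 1 else 0) \<noteq> v"
        by (auto simp: pverts)
      then obtain w where "(v, w) \<in> parcs G"
        using connected_has_neighbor[OF graph connected] v pverts by blast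
      then show ?thesis by (auto simp: nb_def)
    next
      case True
      then have "v \<in> nb v" unfolding nb_def by simp
      then show ?thesis by blast
    qed
    then show ?thesis using many_colors False True by simp
  next
    case F: False
    then have "n = 1" using n_pos by simp
    then have "(0, u) \<notin> parcs G" for u using parcs_verts[of 0 u] E_irrefl[of 0] by (cases u) auto
    then have "nb 0 = {}" using F unfolding nb_def by simp
    then have "\<not> uniq C 0" for C by (simp add: uniq_def)
    then show ?thesis using F n_pos by fastforce
  qed
  then show ?thesis using False ex_coloring_iff by simp
qed

definition array :: "nat \<Rightarrow> nat \<Rightarrow> nat" where
  "array a i = nat (arrs (encode_cf_input (G, X, k)) a (int i))"

lemma arrs_eq: "arrs (encode_cf_input (G, X, k)) a (int i) = int (array a i)"
  by (simp add: array_def encode_cf_input_def Let_def)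

lemma encodes_array: "encodes array"
proof -
  have "int (u * n + v) \<in> (\<lambda>(u, v). int (u * n + v)) ` parcs G \<longleftrightarrow> (u, v) \<in> parcs G"
    if "u < n" "v < n" for u v
  proof
    assume "int (u * n + v) \<in> (\<lambda>(u, v). int (u * n + v)) ` parcs G"
    then obtain u' v' where *: "(u', v') \<in> parcs G" "u * n + v = u' * n + v'" by (auto simp flip: of_nat_add of_nat_mult)
    have "(u * n + v) div n = u" "(u * n + v) mod n = v" "(u' * n + v') div n = u'" "(u' * n + v') mod n = v'"
      using that parcs_verts[OF *(1)] by simp_all
    with * show "(u, v) \<in> parcs G" by simp
  qed force
  then show ?thesis
    by (auto simp: encodes_def array_def encode_cf_input_def Let_def n_def[symmetric] image_iff)
qed

end

text \<open>The quantities in \<open>admissible\<close> after inserting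
  \<open>k \<le> 2 * d + 2\<close>, which holds below the threshold; the sum replaces a
  maximum.\<close>

definition value_bound :: "nat \<Rightarrow> nat" where
  "value_bound d = 2 ^ (2 ^ (6 * (2 ^ (2 * d) * (2 * d + 2)))) + 2 ^ (2 * d) + (2 * d + 2)"

definition loop_bound :: "bool \<Rightarrow> nat \<Rightarrow> nat" where
  "loop_bound cn d = growth vstep_trm (value_bound d) + growth (estep_trm cn) (value_bound d) +
     growth final_trm (value_bound d) + (2 * d + 3)"

lemma definable_loop_bound: "definable (loop_bound cn)"
proof -
  have lin: "definable (\<lambda>d. 2 * d + c)" for c
    by (intro definable_add definable_mult definable_const definable_id)
  have vb: "definable value_bound"
    unfolding value_bound_def
    by (intro definable_add definable_mult definable_pow2 definable_const definable_id)
  show ?thesis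
    unfolding loop_bound_def
    by (intro definable_add definable_comp[OF definable_growth vb] lin)
qed

lemma (in cf_instance) loops_main_trm:
  assumes "e 0 = n" "e 1 = nat k"
  shows "loops_bounded array (n + loop_bound cn d) (main_trm cn) e"
proof (rule loops_main[OF encodes_array assms n_pos])
  assume k: "nat k < 2 * d + 3"
  have "L \<le> 2 ^ (2 * d) * (2 * d + 2)" unfolding L_def using k by (intro mult_left_mono) auto
  then have "(2::nat) ^ (2 ^ (6 * L)) \<le> 2 ^ (2 ^ (6 * (2 ^ (2 * d) * (2 * d + 2))))"
    by (intro power_increasing) auto
  then show "admissible (value_bound d) (n + loop_bound cn d)"
    using k unfolding admissible_def value_bound_def[of d] loop_bound_def by (intro conjI) linarith+
qed (simp add: loop_bound_def)

theorem conflict_free_coloring_fpt: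
  "fixed_parameter_tractable cf_inputs encode_cf_input
     (\<lambda>(G, X, k). card (pverts G)) (\<lambda>(G, X, k). card X)
     (\<lambda>(G, X, k). \<exists>C. conflict_free_coloring cn G k C)"
proof -
  \<comment> \<open>Registers 0 and 1 hold \<open>n\<close> and the adjusted \<open>k\<close>; all
    other variables share register 2, which is 0.\<close>
  define \<rho> :: "nat \<Rightarrow> nat" where "\<rho> x = (if x < 2 then x else 2)" for x
  \<comment> \<open>Terms know natural numbers only, so a negative \<open>k\<close> is set to 0
    beforehand.\<close>
  define p where "p = Seq (If (Less (Var 1) (Const 0)) (Assign 1 (Const 0)) Skip)
    (Seq (compile \<rho> 3 (main_trm cn)) (Assign 0 (Var 3)))"
  obtain K q where Kq: "\<And>A B e. loops_bounded A B (main_trm cn) e \<Longrightarrow> cost A (main_trm cn) e \<le> K * (B + 1) ^ q"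
    using cost_polynomial by blast
  \<comment> \<open>With \<open>F\<close> for the loop bound, the 2 stems from
    \<open>n + F + 1 \<le> (F + 2) * n\<close>; the 7 pays at most 5 for adjusting \<open>k\<close>
    and 2 for moving the answer to variable 0.\<close>
  define f where "f d = K * (loop_bound cn d + 2) ^ q + 7" for d
  have "definable f"
    unfolding f_def
    by (intro definable_add definable_mult definable_power definable_loop_bound definable_const)
  moreover have "\<exists>t s. exec p (encode_cf_input (G, X, k)) t s \<and> t \<le> f (card X) * card (pverts G) ^ q \<and>
      vars s 0 = (if \<exists>C. conflict_free_coloring cn G k C then 1 else 0)"
    if "(G, X, k) \<in> cf_inputs" for G X k
  proof -
    interpret cf_instance G X k cn by standard fact
    define s0 where "s0 = encode_cf_input (G, X, k)"
    define s1 where "s1 = s0\<lparr>vars := (vars s0)(1 := int (nat k))\<rparr>"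
    have vars: "vars s0 = (\<lambda>_. 0)(0 := int n, 1 := k)"
      by (simp add: s0_def encode_cf_input_def n_def Let_def)
    have 1: "\<exists>t\<le>5. exec (If (Less (Var 1) (Const 0)) (Assign 1 (Const 0)) Skip) s0 t s1"
    proof (cases "k < 0")
      case True
      have "exec (If (Less (Var 1) (Const 0)) (Assign 1 (Const 0)) Skip) s0 (bcost (Less (Var 1) (Const 0)) + 2) s1"
        by (rule exec.IfTrue) (use True in \<open>auto intro!: exec_Assign simp: vars s1_def\<close>)
      then show ?thesis by (intro exI conjI[rotated], assumption) auto
    next
      case False
      then have "s1 = s0" by (simp add: s1_def vars fun_upd_idem)
      have "exec (If (Less (Var 1) (Const 0)) (Assign 1 (Const 0)) Skip) s0 (bcost (Less (Var 1) (Const 0)) + 1) s1"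
        unfolding \<open>s1 = s0\<close> 
        by (rule exec.IfFalse[OF _ exec.Skip]) (use False in \<open>simp add: vars\<close>)
      then show ?thesis by (intro exI conjI[rotated], assumption) auto
    qed
    then obtain t1 where 1: "exec (If (Less (Var 1) (Const 0)) (Assign 1 (Const 0)) Skip) s0 t1 s1" "t1 \<le> 5"
      by blast
    define e :: env where "e = (\<lambda>_. 0)(0 := n, 1 := nat k)"
    have "represents \<rho> 3 e array s1"
      unfolding represents_def using arrs_eq by (auto simp: \<rho>_def e_def s1_def vars s0_def[symmetric])
    from compile_yields[OF this, of "main_trm cn"]
    obtain t2 s2 where 2: "exec (compile \<rho> 3 (main_trm cn)) s1 t2 s2" "t2 \<le> cost array (main_trm cn) e"
      "vars s2 3 = int (ev array (main_trm cn) e)" by (elim yieldsE)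
    let ?s3 = "s2\<lparr>vars := (vars s2)(0 := vars s2 3)\<rparr>"
    have 3: "exec (Assign 0 (Var 3)) s2 2 ?s3" by (rule exec_Assign) auto
    have e: "e 0 = n" "e 1 = nat k" by (simp_all add: e_def)
    have "exec p s0 (t1 + (t2 + 2)) ?s3"
      unfolding p_def by (rule exec.Seq[OF 1(1) exec.Seq[OF 2(1) 3]])
    moreover have "vars ?s3 0 = (if \<exists>C. conflict_free_coloring cn G k C then 1 else 0)"
      unfolding answer[symmetric] using ev_main_trm[OF encodes_array e] 2(3) by simp
    moreover have "t1 + (t2 + 2) \<le> f (card X) * card (pverts G) ^ q"
    proof -
      let ?F = "loop_bound cn d"
      have "t2 \<le> K * (n + ?F + 1) ^ q" using 2(2) Kq[OF loops_main_trm[OF e]] by simp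
      also have "n + ?F + 1 \<le> (?F + 2) * n"
      proof -
        have "?F * 1 \<le> ?F * n" using n_pos by (intro mult_left_mono) auto
        then have "n + ?F + 1 \<le> n + ?F * n + n" using n_pos by linarith
        also have "\<dots> = (?F + 2) * n" by (simp add: algebra_simps)
        finally show ?thesis .
      qed
      then have "K * (n + ?F + 1) ^ q \<le> K * ((?F + 2) * n) ^ q" by (intro mult_left_mono power_mono) auto
      also have "\<dots> = K * (?F + 2) ^ q * n ^ q" by (simp only: power_mult_distrib mult.assoc)
      finally have "t2 \<le> K * (?F + 2) ^ q * n ^ q" .
      moreover have "7 * 1 \<le> 7 * n ^ q" using n_pos by (intro mult_left_mono one_le_power) auto
      ultimately have "t1 + (t2 + 2) \<le> f d * n ^ q" using 1(2) by (simp add: f_def distrib_right)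
      then show ?thesis by (simp add: d_def n_def)
    qed
    ultimately show ?thesis unfolding s0_def by blast
  qed
  ultimately show ?thesis
    unfolding fixed_parameter_tractable_def using definable_computable by fastforce
qed

theorem theorem1:
  shows "fixed_parameter_tractable cf_inputs encode_cf_input
           (\<lambda>(G, X, k). card (pverts G)) (\<lambda>(G, X, k). card X)
           (\<lambda>(G, X, k). \<exists>C. cf_cn_coloring G k C)
       \<and> fixed_parameter_tractable cf_inputs encode_cf_input
           (\<lambda>(G, X, k). card (pverts G)) (\<lambda>(G, X, k). card X)
           (\<lambda>(G, X, k). \<exists>C. cf_on_coloring G k C)"
  using conflict_free_coloring_fpt[of True] conflict_free_coloring_fpt[of False]
  by (simp add: conflict_free_coloring_def)

end
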